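(* Let $D$ be a positive integer, let $q$ be a real $D\times D$ matrix with $q(i,j)\ge0$ for $i\ne j$, $q(i,i)=-\sum_{j\neq i}q(i,j)$, and $\mathrm{Id}+q$ irreducible, and let $\nu$ be the unique probability vector with $\nu^\top q=0$. Let $(a_n)_{n\ge1}$ be a sequence of positive numbers with $a_n\to+\infty$. For each $n$, let $\pi^{(n)}$ be the unique stationary distribution of the Markov process $(\mathbf X^{(n)}_t,\mathbf I^{(n)}_t)_{t\ge0}$ on $\triangle\times\{1,\dots,D\}$ with generator $$\mathcal L^{(n)}f(x,i)=(e_i-x)\cdot\nabla_xf(x,i)+a_n\sum_{j\ne i}q(i,j)[f(x,j)-f(x,i)],$$ and let $\bar\pi^{(n)}$ be the probability measure on $\mathbb{R}^D$ which is the image of $\pi^{(n)}$ under $(x,i)\mapsto\sqrt{a_n}(x-\nu)$. Then $(\bar\pi^{(n)})_{n\ge1}$ converges weakly to the centered Gaussian distribution $\mathscr N(0,\Sigma^{(0,1)})$, where $$\Sigma^{(0,1)}_{k,l}=\frac12\sum_{i=1}^D\nu_i\sum_{j=1}^Dq(i,j)(h_{l,j}-h_{l,i})(h_{k,j}-h_{k,i})$$ and $h$ is a solution of the Poisson equation given in the context.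
   Context: $\triangle=\{x\in[0,1]^D:\sum_{i=1}^D x_i=1\}$ and $(e_1,\dots,e_D)$ is the canonical basis of $\mathbb{R}^D$. The process with generator $\mathcal L^{(n)}$: $\mathbf I^{(n)}$ jumps from $i$ to $j\neq i$ at rate $a_nq(i,j)$, and $\mathbf X^{(n)}$ is continuous and solves $\dot{\mathbf X}_t=e_{\mathbf I_t}-\mathbf X_t$ between jumps; it has a unique stationary distribution. Poisson equation: $h=(h_{k,i})_{1\le k,i\le D}$ is a real matrix such that for all $1\le i,k\le D$, $\sum_{j\ne i}q(i,j)(h_{k,j}-h_{k,i})=\nu_k-\mathbf 1_{i=k}$. For each $k$, the row $(h_{k,i})_i$ is determined up to an additive constant, and $\Sigma^{(0,1)}$ does not depend on this choice. The Gaussian distribution may be degenerate. *)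

theory Defs
  imports "HOL-Probability.Probability"
begin

section \<open>Jump rates\<close>

definition rate_matrix :: "real ^ 'd ^ 'd \<Rightarrow> bool" where
  "rate_matrix q \<longleftrightarrow>
     (\<forall>i j. i \<noteq> j \<longrightarrow> 0 \<le> q $ i $ j) \<and>
     (\<forall>i. q $ i $ i = - (\<Sum>j\<in>UNIV - {i}. q $ i $ j))"

text \<open>
  Irreducibility is strong connectedness of the directed graph of the nonzero entries. It is phrased
  with paths rather than with powers of the matrix because the diagonal of \<open>mat 1 + q\<close> may be
  negative.
\<close>
definition irreducible_matrix :: "real ^ 'd ^ 'd \<Rightarrow> bool" where
  "irreducible_matrix A \<longleftrightarrow> (\<forall>i j. (i, j) \<in> {(k, l). A $ k $ l \<noteq> 0}\<^sup>+)"

definition prob_simplex :: "(real ^ 'd) set" where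
  "prob_simplex = {x. (\<forall>i. x $ i \<in> {0..1}) \<and> (\<Sum>i\<in>UNIV. x $ i) = 1}"


section \<open>Markov processes on the simplex times the index set\<close>

definition state_space :: "((real ^ 'd) \<times> 'd) measure" where
  "state_space = restrict_space (borel \<Otimes>\<^sub>M count_space UNIV) (prob_simplex \<times> UNIV)"

text \<open>
  A (time-homogeneous) Markov process is represented by its transition semigroup: \<open>P t z\<close> is the
  law of the process at time \<open>t\<close> when it starts at \<open>z\<close>. Negative times are irrelevant.
\<close>
definition markov_semigroup :: "'s measure \<Rightarrow> (real \<Rightarrow> 's \<Rightarrow> 's measure) \<Rightarrow> bool" where
  "markov_semigroup S P \<longleftrightarrow>
     (\<forall>t\<ge>0. P t \<in> S \<rightarrow>\<^sub>M prob_algebra S) \<and>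
     (\<forall>z\<in>space S. P 0 z = return S z) \<and>
     (\<forall>s\<ge>0. \<forall>t\<ge>0. \<forall>z\<in>space S. P (s + t) z = P s z \<bind> P t)"

definition stationary_distribution ::
    "'s measure \<Rightarrow> (real \<Rightarrow> 's \<Rightarrow> 's measure) \<Rightarrow> 's measure \<Rightarrow> bool" where
  "stationary_distribution S P \<mu> \<longleftrightarrow>
     \<mu> \<in> space (prob_algebra S) \<and> (\<forall>t\<ge>0. \<mu> \<bind> P t = \<mu>)"

definition grad :: "('a::real_inner \<Rightarrow> real) \<Rightarrow> 'a \<Rightarrow> 'a" where
  "grad f x = (THE D. GDERIV f x :> D)"

text \<open>
  Test functions are continuously differentiable in the first variable on the whole space, so that
  \<open>grad\<close> is defined at every point of the simplex, which has empty interior.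
\<close>
definition C1_test_function :: "((real ^ 'd) \<times> 'd \<Rightarrow> real) \<Rightarrow> bool" where
  "C1_test_function f \<longleftrightarrow>
     (\<forall>i. (\<forall>x. \<exists>D. GDERIV (\<lambda>y. f (y, i)) x :> D) \<and>
          continuous_on UNIV (grad (\<lambda>y. f (y, i))))"

definition switching_generator ::
    "real \<Rightarrow> real ^ 'd ^ 'd \<Rightarrow> ((real ^ 'd) \<times> 'd \<Rightarrow> real) \<Rightarrow> (real ^ 'd) \<times> 'd \<Rightarrow> real" where
  "switching_generator a q f = (\<lambda>(x, i).
     (axis i 1 - x) \<bullet> grad (\<lambda>y. f (y, i)) x +
     a * (\<Sum>j\<in>UNIV - {i}. q $ i $ j * (f (x, j) - f (x, i))))"

text \<open>
  \<open>L\<close> is the (strong) infinitesimal generator of \<open>P\<close> on \<open>C1_test_function\<close>: the difference quotients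
  at time 0 converge to \<open>L f\<close> in the supremum norm. For \<open>switching_generator a q\<close> these test
  functions are invariant under the transition semigroup of the switching process, hence a core, so
  that at most one semigroup has this generator.
\<close>
definition has_generator ::
    "(real \<Rightarrow> (real ^ 'd) \<times> 'd \<Rightarrow> ((real ^ 'd) \<times> 'd) measure) \<Rightarrow>
     (((real ^ 'd) \<times> 'd \<Rightarrow> real) \<Rightarrow> (real ^ 'd) \<times> 'd \<Rightarrow> real) \<Rightarrow> bool" where
  "has_generator P L \<longleftrightarrow>
     (\<forall>f. C1_test_function f \<longrightarrow>
        uniform_limit (prob_simplex \<times> UNIV)
          (\<lambda>t z. ((\<integral>w. f w \<partial>(P t z)) - f z) / t) (L f) (at_right 0))"


section \<open>The limiting covariance\<close>

definition poisson_solution :: "real ^ 'd ^ 'd \<Rightarrow> real ^ 'd \<Rightarrow> real ^ 'd ^ 'd \<Rightarrow> bool" where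
  "poisson_solution q \<nu> h \<longleftrightarrow>
     (\<forall>i k. (\<Sum>j\<in>UNIV - {i}. q $ i $ j * (h $ k $ j - h $ k $ i))
              = \<nu> $ k - (if i = k then 1 else 0))"

definition Sigma01 :: "real ^ 'd ^ 'd \<Rightarrow> real ^ 'd \<Rightarrow> real ^ 'd ^ 'd \<Rightarrow> real ^ 'd ^ 'd" where
  "Sigma01 q \<nu> h = (\<chi> k l. 1 / 2 * (\<Sum>i\<in>UNIV. \<nu> $ i *
     (\<Sum>j\<in>UNIV. q $ i $ j * (h $ l $ j - h $ l $ i) * (h $ k $ j - h $ k $ i))))"


section \<open>Gaussian distributions and weak convergence\<close>

text \<open>The real normal law with mean \<open>m\<close> and standard deviation \<open>s \<ge> 0\<close>; a point mass if \<open>s = 0\<close>.\<close>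
definition normal_law :: "real \<Rightarrow> real \<Rightarrow> real measure" where
  "normal_law m s = (if s = 0 then return borel m else density lborel (normal_density m s))"

text \<open>
  A law is centered Gaussian with covariance \<open>C\<close>, possibly degenerate, if every linear form is
  normally distributed with mean 0 and variance given by the quadratic form of \<open>C\<close>. This
  determines the law uniquely.
\<close>
definition centered_gaussian :: "real ^ 'd ^ 'd \<Rightarrow> (real ^ 'd) measure \<Rightarrow> bool" where
  "centered_gaussian C \<mu> \<longleftrightarrow>
     prob_space \<mu> \<and> sets \<mu> = sets borel \<and> transpose C = C \<and>
     (\<forall>\<theta>. 0 \<le> \<theta> \<bullet> (C *v \<theta>) \<and>
          distr \<mu> borel (\<lambda>x. \<theta> \<bullet> x) = normal_law 0 (sqrt (\<theta> \<bullet> (C *v \<theta>))))"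

definition converges_weakly ::
    "(nat \<Rightarrow> 'a::topological_space measure) \<Rightarrow> 'a measure \<Rightarrow> bool" where
  "converges_weakly \<mu> \<mu>' \<longleftrightarrow>
     (\<forall>f :: 'a \<Rightarrow> real. continuous_on UNIV f \<and> bounded (range f) \<longrightarrow>
        (\<lambda>n. \<integral>x. f x \<partial>(\<mu> n)) \<longlonglongrightarrow> (\<integral>x. f x \<partial>\<mu>'))"

end

theory Submission
  imports Defs
begin

text \<open>
  Fix a direction \<open>\<theta>\<close> and let \<open>u = sqrt a * \<theta> \<bullet> (X - \<nu>)\<close> be the rescaled fluctuation under the stationary
  law. Stationarity says that \<open>E[L f] = 0\<close> for every test function \<open>f\<close>
  (\<open>stationary_integral_generator_eq_0\<close>). For \<open>f = \<psi>(u)\<close>,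
  \<open>L f = - u \<psi>'(u) + sqrt a * (\<theta>\<^sub>I - \<theta> \<bullet> \<nu>) * \<psi>'(u)\<close>.
  The second term is large, but \<open>\<theta>\<^sub>i - \<theta> \<bullet> \<nu>\<close> has \<open>\<nu>\<close>-mean zero, so the fast jumps average it out.
  This is made exact with correctors taken from the Poisson equation: adding \<open>H\<^sub>i \<psi>'(u) / sqrt a\<close> with
  \<open>H = \<theta> v* h\<close> cancels the large term and leaves \<open>H\<^sub>i (\<theta>\<^sub>i - \<theta> \<bullet> \<nu>) \<psi>''(u)\<close>, and a second corrector of
  order \<open>1 / a\<close> replaces that coefficient by its \<open>\<nu>\<close>-mean. An integration by parts for \<open>q\<close> under \<open>\<nu>\<close>
  shows that the mean is \<open>\<sigma>\<^sup>2 = \<theta> \<bullet> (Sigma01 q \<nu> h *v \<theta>)\<close> (\<open>Sigma01_quadratic_form_poisson\<close>). Hence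
  \<open>E[- u \<psi>'(u) + \<sigma>\<^sup>2 \<psi>''(u)] = O(1 / sqrt a)\<close>, an approximate Stein equation for the centered normal law
  of variance \<open>\<sigma>\<^sup>2\<close>.

  With \<open>\<psi>\<close> quadratic, the first corrector alone bounds \<open>E[u\<^sup>2]\<close> uniformly in \<open>a\<close> (\<open>second_moment_fluctuation\<close>), which
  gives tightness. With \<open>\<psi>\<close> a cosine of frequency \<open>s\<close>, it becomes a linear differential equation in \<open>s\<close>, up to
  \<open>O(1 / sqrt a)\<close>, for \<open>E[cos (s u + c)]\<close>; solving it from \<open>s = 0\<close> to \<open>s = 1\<close> yields convergence to the
  Gaussian value (\<open>expectation_cos_fluctuation_approx\<close>).

  It remains to pass from characteristic functions to weak convergence in several dimensions
  (\<open>converges_weakly_if_tight_and_cos_converge\<close>), by approximating bounded continuous functions with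
  trigonometric polynomials, and to exhibit the limit law as a linear image of independent standard
  normal variables (\<open>centered_gaussian_Sigma01_exists\<close>).
\<close>


section \<open>Stationarity in terms of the generator\<close>

lemma grad_eq: "GDERIV f x :> D \<Longrightarrow> grad f x = D"
  unfolding grad_def
proof (rule the_equality, assumption)
  fix E assume "GDERIV f x :> E" "GDERIV f x :> D"
  then have "(\<lambda>h. inner h E) = (\<lambda>h. inner h D)"
    unfolding gderiv_def by (rule has_derivative_unique)
  then show "E = D" by (metis vector_eq_ldot)
qed

lemma compact_prob_simplex: "compact (prob_simplex :: (real^'d) set)"
proof -
  have eq: "(prob_simplex :: (real^'d) set) = cbox 0 1 \<inter> {x. (\<Sum>i\<in>UNIV. x $ i) = 1}"
    unfolding prob_simplex_def by (auto simp: mem_box_cart)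
  have "closed {x::real^'d. (\<Sum>i\<in>UNIV. x $ i) = 1}"
    by (intro closed_Collect_eq continuous_intros)
  then show ?thesis unfolding eq by (intro compact_Int_closed) auto
qed

lemma space_state_space: "space state_space = prob_simplex \<times> UNIV"
  by (simp add: state_space_def space_restrict_space space_pair_measure)

text \<open>
  The test functions and their images under the generator are continuous on each of the finitely many
  copies of the simplex. This alone makes them measurable, bounded (the simplex is compact) and
  integrable against every probability measure on the state space.
\<close>
lemma measurable_fibrewise_continuous:
  assumes "\<And>i. continuous_on UNIV (\<lambda>x. g (x, i))"
  shows "(g :: (real^'d) \<times> 'd \<Rightarrow> 'b::topological_space) \<in> borel_measurable state_space"
proof -
  have "(\<lambda>z. g (fst z, snd z))
      \<in> borel_measurable (borel \<Otimes>\<^sub>M (count_space UNIV :: 'd measure))"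
  proof (rule measurable_compose_countable'[where f = "\<lambda>i z. g (fst z, i)" and g = snd and I = UNIV])
    fix i
    have [measurable]: "(\<lambda>x. g (x, i)) \<in> borel_measurable borel"
      by (rule borel_measurable_continuous_onI) (rule assms)
    show "(\<lambda>z. g (fst z, i)) \<in> borel_measurable (borel \<Otimes>\<^sub>M (count_space UNIV :: 'd measure))"
      by measurable
  qed (auto intro: countable_finite)
  then show ?thesis
    unfolding state_space_def by (intro measurable_restrict_space1) simp
qed

lemma bounded_fibrewise_continuous:
  assumes "\<And>i. continuous_on UNIV (\<lambda>x. g (x, i))"
  obtains B where "\<And>z. z \<in> space state_space \<Longrightarrow> \<bar>g z :: real\<bar> \<le> B"
proof -
  have "bounded (\<Union>i. (\<lambda>x. g (x, i)) ` prob_simplex)"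
    by (intro bounded_UN ballI compact_imp_bounded compact_continuous_image
        continuous_on_subset[OF assms] compact_prob_simplex) auto
  then obtain B where B: "\<And>y. y \<in> (\<Union>i. (\<lambda>x. g (x, i)) ` prob_simplex) \<Longrightarrow> norm y \<le> B"
    unfolding bounded_iff by blast
  show ?thesis
    by (rule that[of B]) (auto simp: space_state_space simp flip: real_norm_def intro!: B)
qed

lemma integrable_fibrewise_continuous:
  assumes "\<mu> \<in> space (prob_algebra state_space)"
    and "\<And>i. continuous_on UNIV (\<lambda>x. g (x, i) :: real)"
  shows "integrable \<mu> g"
proof -
  obtain B where "\<And>z. z \<in> space state_space \<Longrightarrow> \<bar>g z\<bar> \<le> B"
    using bounded_fibrewise_continuous[OF assms(2)] by metis
  moreover have [measurable_cong]: "sets \<mu> = sets state_space" and p: "prob_space \<mu>"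
    using assms(1) by (auto simp: space_prob_algebra)
  interpret prob_space \<mu> by fact
  have "space \<mu> = space state_space" by (rule sets_eq_imp_space_eq) fact
  ultimately show ?thesis
    using measurable_fibrewise_continuous[of g, OF assms(2)]
    by (intro integrable_const_bound[of _ B]) (auto cong: measurable_cong_sets)
qed

text \<open>
  Stationarity gives \<open>\<integral> P\<^sub>t f d\<mu> = \<integral> f d\<mu>\<close>, so every difference quotient \<open>(P\<^sub>t f - f) / t\<close> has
  \<open>\<mu>\<close>-mean zero. The quotients converge to \<open>L f\<close> uniformly, hence \<open>L f\<close> has mean zero as well. All the
  information on the stationary distributions used below comes from this identity.
\<close>
lemma stationary_integral_generator_eq_0:
  fixes P :: "real \<Rightarrow> (real ^ 'd) \<times> 'd \<Rightarrow> ((real ^ 'd) \<times> 'd) measure"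
  assumes sg: "markov_semigroup state_space P"
    and gen: "has_generator P L"
    and st: "stationary_distribution state_space P \<mu>"
    and f: "C1_test_function f"
    and Lf: "\<And>i. continuous_on UNIV (\<lambda>x. L f (x, i))"
  shows "(\<integral>z. L f z \<partial>\<mu>) = 0"
proof -
  have \<mu>: "\<mu> \<in> space (prob_algebra state_space)" and inv: "\<And>t. t \<ge> 0 \<Longrightarrow> \<mu> \<bind> P t = \<mu>"
    using st by (auto simp: stationary_distribution_def)
  have [measurable_cong]: "sets \<mu> = sets state_space" and p: "prob_space \<mu>"
    using \<mu> by (auto simp: space_prob_algebra)
  interpret prob_space \<mu> by fact
  have sp: "space \<mu> = space state_space" by (rule sets_eq_imp_space_eq) fact
  have fc: "\<And>i. continuous_on UNIV (\<lambda>x. f (x, i))"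
  proof -
    fix i show "continuous_on UNIV (\<lambda>x. f (x, i))"
      using f unfolding C1_test_function_def gderiv_def
      by (metis has_derivative_continuous continuous_at_imp_continuous_on)
  qed
  note fm [measurable] = measurable_fibrewise_continuous[of f, OF fc]
  obtain B where B: "\<And>z. z \<in> space state_space \<Longrightarrow> \<bar>f z\<bar> \<le> B"
    using bounded_fibrewise_continuous[of f, OF fc] by metis
  note fi = integrable_fibrewise_continuous[OF \<mu> fc]
  note Li = integrable_fibrewise_continuous[OF \<mu> Lf]
  define A where "A = (\<lambda>t z. \<integral>w. f w \<partial>(P t z))"
  have A: "integrable \<mu> (A t) \<and> integral\<^sup>L \<mu> (A t) = integral\<^sup>L \<mu> f" if "t \<ge> 0" for t
  proof -
    have P: "P t \<in> state_space \<rightarrow>\<^sub>M prob_algebra state_space"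
      using sg that by (auto simp: markov_semigroup_def)
    have K [measurable]: "P t \<in> \<mu> \<rightarrow>\<^sub>M subprob_algebra state_space"
      using measurable_prob_algebraD[OF P] by measurable
    have m: "A t \<in> borel_measurable \<mu>" unfolding A_def by measurable
    have "\<bar>A t z\<bar> \<le> B" if z: "z \<in> space \<mu>" for z
    proof -
      have "P t z \<in> space (prob_algebra state_space)"
        using P z sp by (auto dest: measurable_space)
      then have s: "sets (P t z) = sets state_space" and q: "prob_space (P t z)"
        by (auto simp: space_prob_algebra)
      interpret q: prob_space "P t z" by fact
      have "\<bar>A t z\<bar> \<le> (\<integral>w. \<bar>f w\<bar> \<partial>(P t z))" unfolding A_def by simp
      also have "\<dots> \<le> B"
        by (rule q.integral_le_const)
          (use s fm sets_eq_imp_space_eq[OF s] B in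
            \<open>auto intro!: q.integrable_const_bound[of _ B] AE_I2 cong: measurable_cong_sets\<close>)
      finally show ?thesis .
    qed
    then have "integrable \<mu> (A t)" using m by (intro integrable_const_bound[of _ B]) auto
    moreover have le1: "AE z in \<mu>. emeasure (P t z) (space (P t z)) \<le> ennreal 1"
      using subprob_space.emeasure_space_le_1[OF subprob_space_kernel[OF K]] by auto
    moreover have "integral\<^sup>L (\<mu> \<bind> P t) f = integral\<^sup>L \<mu> (A t)"
      unfolding A_def
      by (rule integral_bind[OF fm B K finite_measure_axioms le1])
    ultimately show ?thesis using inv[OF that] by simp
  qed
  have "\<bar>\<integral>z. L f z \<partial>\<mu>\<bar> \<le> e" if "e > 0" for e
  proof -
    have "uniform_limit (prob_simplex \<times> UNIV) (\<lambda>t z. (A t z - f z) / t) (L f) (at_right 0)"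
      using gen f by (auto simp: has_generator_def A_def)
    then have "eventually (\<lambda>t. \<forall>z\<in>prob_simplex \<times> UNIV. dist ((A t z - f z) / t) (L f z) < e)
        (at_right 0)"
      using that by (auto simp: uniform_limit_iff)
    then have "eventually (\<lambda>t::real. (\<forall>z\<in>prob_simplex \<times> UNIV. dist ((A t z - f z) / t) (L f z) < e)
        \<and> t > 0) (at_right 0)"
      by (intro eventually_conj eventually_at_right_less)
    from eventually_happens'[OF trivial_limit_at_right_real this] obtain t where t: "t > 0" and
      d: "\<And>z. z \<in> space \<mu> \<Longrightarrow> dist ((A t z - f z) / t) (L f z) < e"
      unfolding sp space_state_space by blast
    have At: "integrable \<mu> (A t)" "integral\<^sup>L \<mu> (A t) = integral\<^sup>L \<mu> f" using A t by auto
    have i: "integrable \<mu> (\<lambda>z. (A t z - f z) / t)" using At fi by simp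
    have "(\<integral>z. L f z \<partial>\<mu>) = (\<integral>z. L f z - (A t z - f z) / t \<partial>\<mu>)"
      using At fi Li i by simp
    also have "\<bar>\<dots>\<bar> \<le> (\<integral>z. \<bar>L f z - (A t z - f z) / t\<bar> \<partial>\<mu>)" by simp
    also have "\<dots> \<le> e"
      by (rule integral_le_const) (use i Li d in \<open>auto intro!: AE_I2 simp: dist_real_def abs_minus_commute less_imp_le\<close>)
    finally show ?thesis .
  qed
  then show ?thesis using field_le_epsilon[of "\<bar>\<integral>z. L f z \<partial>\<mu>\<bar>" 0] by auto
qed

section \<open>Weak convergence from characteristic functions\<close>

text \<open>
  Real trigonometric polynomials with arbitrary frequency vectors. Phases replace the sines, so that
  one kind of generator suffices and products reduce to \<open>cos u cos v = (cos (u - v) + cos (u + v)) / 2\<close>.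
\<close>
inductive trig_poly :: "('a::real_inner \<Rightarrow> real) \<Rightarrow> bool" where
  wave: "trig_poly (\<lambda>x. b * cos (\<theta> \<bullet> x + c))"
| add: "trig_poly f \<Longrightarrow> trig_poly g \<Longrightarrow> trig_poly (\<lambda>x. f x + g x)"

lemma trig_poly_const: "trig_poly (\<lambda>x. b)"
  using trig_poly.wave[of b 0 0] by simp

lemma trig_poly_sin: "trig_poly (\<lambda>x. b * sin (\<theta> \<bullet> x))"
  using trig_poly.wave[of b \<theta> "- (pi / 2)"] by (simp add: cos_diff)

lemma trig_poly_sum:
  assumes "finite I" "\<And>i. i \<in> I \<Longrightarrow> trig_poly (f i)"
  shows "trig_poly (\<lambda>x. \<Sum>i\<in>I. f i x)"
  using assms by (induction I rule: finite_induct) (auto intro: trig_poly_const trig_poly.add)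

lemma trig_poly_mult:
  assumes "trig_poly f" "trig_poly g"
  shows "trig_poly (\<lambda>x. f x * g x)"
  using assms(1)
proof induction
  case (wave b \<theta> c)
  from assms(2) show ?case
  proof induction
    case (wave b' \<theta>' c')
    have eq: "(\<lambda>x. b * cos (\<theta> \<bullet> x + c) * (b' * cos (\<theta>' \<bullet> x + c')))
      = (\<lambda>x. (b * b' / 2) * cos ((\<theta> - \<theta>') \<bullet> x + (c - c')) + (b * b' / 2) * cos ((\<theta> + \<theta>') \<bullet> x + (c + c')))"
      (is "?l = ?r")
    proof
      fix x
      have "cos (\<theta> \<bullet> x + c) * cos (\<theta>' \<bullet> x + c')
          = (cos ((\<theta> - \<theta>') \<bullet> x + (c - c')) + cos ((\<theta> + \<theta>') \<bullet> x + (c + c'))) / 2"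
        by (simp add: cos_times_cos inner_diff_left inner_add_left algebra_simps)
          (metis add.commute add_diff_eq cos_minus diff_add_eq minus_diff_eq)
      then show "?l x = ?r x" by (simp add: field_simps)
    qed
    show ?case unfolding eq by (intro trig_poly.intros)
  next
    case (add f g)
    then show ?case by (simp add: distrib_left trig_poly.add)
  qed
next
  case (add f g)
  then show ?case by (simp add: distrib_right trig_poly.add)
qed

lemma trig_poly_continuous: "trig_poly f \<Longrightarrow> continuous_on UNIV f"
  by (induction rule: trig_poly.induct) (auto intro!: continuous_intros)

lemma trig_poly_bounded: "trig_poly f \<Longrightarrow> \<exists>B. \<forall>x. \<bar>f x\<bar> \<le> B"
proof (induction rule: trig_poly.induct)
  case (wave b \<theta> c)
  have "\<bar>b * cos (\<theta> \<bullet> x + c)\<bar> \<le> \<bar>b\<bar>" for x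
    by (simp add: abs_mult mult_left_le)
  then show ?case by blast
next
  case (add f g)
  then show ?case by (meson abs_triangle_ineq add_mono order_trans)
qed

text \<open>
  The map \<open>y \<mapsto> (M sin (y\<^sub>b / M))\<^sub>b\<close>. It is close to the identity on a fixed ball when \<open>M\<close> is large, it
  sends the whole space into a bounded set, and composing a polynomial with it yields a trigonometric
  polynomial.
\<close>
definition sine_box :: "real \<Rightarrow> 'a::euclidean_space \<Rightarrow> 'a" where
  "sine_box M y = (\<Sum>b\<in>Basis. (M * sin ((b /\<^sub>R M) \<bullet> y)) *\<^sub>R b)"

lemma norm_sine_box_le:
  assumes "M \<ge> 0" shows "norm (sine_box M (y::'a::euclidean_space)) \<le> M * DIM('a)"
proof -
  have "norm (sine_box M y) \<le> (\<Sum>b\<in>(Basis::'a set). M)"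
    unfolding sine_box_def using assms
    by (intro sum_norm_le) (auto simp: abs_mult intro: mult_left_le)
  then show ?thesis by (simp add: mult.commute)
qed

lemma norm_sine_box_diff_le:
  fixes y :: "'a::euclidean_space"
  assumes "M > 0" shows "norm (y - sine_box M y) \<le> DIM('a) * (norm y)\<^sup>2 / (2 * M)"
proof -
  have "y - sine_box M y = (\<Sum>b\<in>Basis. (y \<bullet> b - M * sin ((b /\<^sub>R M) \<bullet> y)) *\<^sub>R b)"
    unfolding sine_box_def by (simp add: scaleR_diff_left sum_subtractf euclidean_representation)
  also have "norm \<dots> \<le> (\<Sum>b\<in>(Basis::'a set). (norm y)\<^sup>2 / (2 * M))"
  proof (rule sum_norm_le)
    fix b :: 'a assume b: "b \<in> Basis"
    let ?t = "y \<bullet> b"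
    have eq: "(b /\<^sub>R M) \<bullet> y = ?t / M" by (simp add: inner_commute divide_inverse_commute)
    have "\<bar>sin (?t / M) - ?t / M\<bar> \<le> (?t / M)\<^sup>2 / 2"
      using Maclaurin_sin_bound[of "?t / M" 2] by (simp add: sin_coeff_def eval_nat_numeral)
    then have "M * \<bar>sin (?t / M) - ?t / M\<bar> \<le> M * ((?t / M)\<^sup>2 / 2)"
      using assms by (intro mult_left_mono) auto
    also have "\<dots> = ?t\<^sup>2 / (2 * M)" using assms by (simp add: field_simps power2_eq_square)
    also have "\<dots> \<le> (norm y)\<^sup>2 / (2 * M)"
      using assms Basis_le_norm[OF b, of y] by (intro divide_right_mono) (auto intro: abs_le_square_iff[THEN iffD1])
    also have "M * \<bar>sin (?t / M) - ?t / M\<bar> = \<bar>?t - M * sin (?t / M)\<bar>"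
    proof -
      have "M * \<bar>sin (?t / M) - ?t / M\<bar> = \<bar>M * (sin (?t / M) - ?t / M)\<bar>"
        using assms by (simp add: abs_mult)
      also have "\<dots> = \<bar>?t - M * sin (?t / M)\<bar>"
        using assms by (simp add: right_diff_distrib abs_minus_commute)
      finally show ?thesis .
    qed
    finally show "norm ((y \<bullet> b - M * sin ((b /\<^sub>R M) \<bullet> y)) *\<^sub>R b) \<le> (norm y)\<^sup>2 / (2 * M)"
      unfolding eq using b by simp
  qed
  finally show ?thesis by simp
qed

lemma trig_poly_polynomial_sine_box:
  fixes p :: "'a::euclidean_space \<Rightarrow> real"
  assumes "real_polynomial_function p"
  shows "trig_poly (\<lambda>y. p (sine_box M y))"
  using assms
proof (induction rule: real_polynomial_function.induct)
  case (linear p)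
  interpret bounded_linear p by fact
  have "(\<lambda>y. p (sine_box M y)) = (\<lambda>y. \<Sum>b\<in>Basis. (M * p b) * sin ((b /\<^sub>R M) \<bullet> y))"
    unfolding sine_box_def by (simp add: sum scaleR mult_ac)
  then show ?case by (simp only: trig_poly_sum[OF finite_Basis trig_poly_sin])
qed (auto intro: trig_poly_const trig_poly.add trig_poly_mult)

text \<open>
  A continuous function is approximated on a large ball by a trigonometric polynomial that keeps the
  bound of the function on the whole space. Approximate the function by a polynomial \<open>p\<close> on the
  bounded range of \<open>sine_box M\<close>: then \<open>p \<circ> sine_box M\<close> is uniformly close to \<open>f \<circ> sine_box M\<close>
  everywhere, and \<open>f \<circ> sine_box M\<close> is close to \<open>f\<close> on the ball.
\<close>
lemma trig_poly_approximation:
  fixes f :: "'a::euclidean_space \<Rightarrow> real"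
  assumes f: "continuous_on UNIV f" and B: "\<And>y. \<bar>f y\<bar> \<le> B" and e: "e > 0"
  obtains g where "trig_poly g" "\<And>y. norm y \<le> R \<Longrightarrow> \<bar>f y - g y\<bar> \<le> e" "\<And>y. \<bar>g y\<bar> \<le> B + e"
proof -
  have "uniformly_continuous_on (cball 0 (R + 1)) f"
    by (intro compact_uniformly_continuous continuous_on_subset[OF f]) auto
  then obtain d where d: "d > 0" and
    fd: "\<And>x y. norm x \<le> R + 1 \<Longrightarrow> norm y \<le> R + 1 \<Longrightarrow> dist x y < d \<Longrightarrow> dist (f x) (f y) < e / 2"
    using e unfolding uniformly_continuous_on_def by (metis dist_0_norm half_gt_zero mem_cball)
  \<comment> \<open>The cap at 1 keeps \<open>sine_box M y\<close> in the ball of radius \<open>R + 1\<close>, where \<open>d\<close> is a modulus of continuity.\<close>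
  define m where "m = min d 1"
  define M where "M = DIM('a) * R\<^sup>2 / m + 1"
  have m: "m > 0" "m \<le> d" "m \<le> 1" using d by (auto simp: m_def)
  have M: "M > 0" using m by (auto simp: M_def add_nonneg_pos)
  have near: "dist y (sine_box M y) < m" if "norm y \<le> R" for y :: 'a
  proof -
    have "(norm y)\<^sup>2 \<le> R\<^sup>2" using that by (simp add: power_mono)
    then have "dist y (sine_box M y) \<le> DIM('a) * R\<^sup>2 / (2 * M)"
      unfolding dist_norm using M
      by (intro order_trans[OF norm_sine_box_diff_le[OF M]] divide_right_mono mult_left_mono) auto
    also have "\<dots> < m"
    proof -
      have "DIM('a) * R\<^sup>2 < m * M" using m by (simp add: M_def distrib_left)
      also have "\<dots> \<le> m * (2 * M)" using m M by simp
      finally show ?thesis using M by (simp add: pos_divide_less_eq)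
    qed
    finally show ?thesis .
  qed
  obtain p where p: "real_polynomial_function p"
    "\<And>x. x \<in> cball 0 (M * DIM('a)) \<Longrightarrow> \<bar>f x - p x\<bar> < e / 2"
    using Stone_Weierstrass_real_polynomial_function[of "cball 0 (M * DIM('a))" f "e / 2"]
      e continuous_on_subset[OF f] by (metis compact_cball half_gt_zero subset_UNIV)
  have p': "\<bar>f (sine_box M y) - p (sine_box M y)\<bar> < e / 2" for y
    using norm_sine_box_le[of M y] M by (intro p) auto
  show ?thesis
  proof (rule that[of "\<lambda>y. p (sine_box M y)"])
    show "trig_poly (\<lambda>y. p (sine_box M y))" using p by (intro trig_poly_polynomial_sine_box)
    show "\<bar>f y - p (sine_box M y)\<bar> \<le> e" if "norm y \<le> R" for y
    proof -
      have n: "dist y (sine_box M y) < m" using near that by auto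
      have "norm (sine_box M y) \<le> norm y + dist y (sine_box M y)"
        by (metis dist_norm norm_minus_commute norm_triangle_sub)
      then have "dist (f y) (f (sine_box M y)) < e / 2"
        using n that m by (intro fd) auto
      then show ?thesis using p'[of y] unfolding dist_real_def by linarith
    qed
    show "\<bar>p (sine_box M y)\<bar> \<le> B + e" for y
      using p'[of y] B[of "sine_box M y"] e by linarith
  qed
qed

lemma integrable_continuous_bounded:
  fixes f :: "'a::euclidean_space \<Rightarrow> real"
  assumes "prob_space M" "sets M = sets borel" "continuous_on UNIV f" "\<And>y. \<bar>f y\<bar> \<le> B"
  shows "integrable M f"
proof -
  interpret prob_space M by fact
  have "f \<in> borel_measurable M"
    using borel_measurable_continuous_onI[OF assms(3)] assms(2) by (simp cong: measurable_cong_sets)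
  then show ?thesis using assms(4) by (intro integrable_const_bound[of _ B]) auto
qed

lemma integral_diff_le_tail:
  fixes f g :: "'a::euclidean_space \<Rightarrow> real"
  assumes p: "prob_space M" and s: "sets M = sets borel"
    and f: "continuous_on UNIV f" "\<And>y. \<bar>f y\<bar> \<le> B" and g: "continuous_on UNIV g" "\<And>y. \<bar>g y\<bar> \<le> B'"
    and e: "0 \<le> e" and near: "\<And>y. norm y \<le> R \<Longrightarrow> \<bar>f y - g y\<bar> \<le> e"
  shows "\<bar>integral\<^sup>L M f - integral\<^sup>L M g\<bar> \<le> e + (B + B') * measure M {y. norm y > R}"
proof -
  interpret prob_space M by fact
  have i: "integrable M f" "integrable M g"
    using integrable_continuous_bounded[OF p s] f g by blast+
  have T [measurable]: "{y. norm y > R} \<in> sets M" unfolding s by (simp add: borel_open open_Collect_less)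
  have Ti: "integrable M (indicat_real {y. norm y > R})"
    using T by (simp add: emeasure_eq_measure)
  have BB: "0 \<le> B" "0 \<le> B'" using f(2)[of 0] g(2)[of 0] by linarith+
  have "\<bar>integral\<^sup>L M f - integral\<^sup>L M g\<bar> = \<bar>\<integral>y. f y - g y \<partial>M\<bar>" using i by simp
  also have "\<dots> \<le> (\<integral>y. \<bar>f y - g y\<bar> \<partial>M)" by simp
  also have "\<dots> \<le> (\<integral>y. e + (B + B') * indicator {y. norm y > R} y \<partial>M)"
  proof (rule integral_mono)
    fix y
    show "\<bar>f y - g y\<bar> \<le> e + (B + B') * indicator {y. norm y > R} y"
      using near[of y] f(2)[of y] g(2)[of y] BB e by (cases "norm y \<le> R") auto
  qed (use i Ti in auto)
  also have "\<dots> = e + (B + B') * measure M {y. norm y > R}"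
    using Ti T by (simp add: prob_space)
  finally show ?thesis .
qed

lemma tail_le:
  fixes M :: "'a::euclidean_space measure"
  assumes "prob_space M" "sets M = sets borel" "e > 0"
  obtains R where "measure M {y. norm y > R} \<le> e"
proof -
  interpret prob_space M by fact
  have "(\<lambda>n. measure M {y. norm y > real n}) \<longlonglongrightarrow> measure M (\<Inter>n. {y. norm y > real n})"
    by (intro finite_Lim_measure_decseq)
      (auto simp: assms(2) decseq_def borel_open open_Collect_less)
  also have "(\<Inter>n. {y::'a. norm y > real n}) = {}"
    by (simp add: set_eq_iff not_less real_arch_simple)
  finally have "(\<lambda>n. measure M {y. norm y > real n}) \<longlonglongrightarrow> 0" by simp
  then have "eventually (\<lambda>n. measure M {y. norm y > real n} < e) sequentially"
    using assms(3) by (rule order_tendstoD)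
  from eventually_happens'[OF sequentially_bot this] show ?thesis using that less_imp_le by blast
qed

text \<open>
  A form of the continuity theorem in several dimensions, with convergence of characteristic functions
  expressed by cosines with phases. The integrals of trigonometric polynomials converge by linearity,
  and by tightness the error in replacing a bounded continuous function by its trigonometric
  approximation is small uniformly in \<open>n\<close>.
\<close>
theorem converges_weakly_if_tight_and_cos_converge:
  fixes \<mu> :: "nat \<Rightarrow> 'a::euclidean_space measure"
  assumes \<mu>: "\<And>n. prob_space (\<mu> n)" "\<And>n. sets (\<mu> n) = sets borel"
    and G: "prob_space G" "sets G = sets borel"
    and tight: "\<And>e. e > 0 \<Longrightarrow> \<exists>R. \<forall>n. measure (\<mu> n) {y. norm y > R} \<le> e"
    and cos: "\<And>\<theta> c. (\<lambda>n. \<integral>y. cos (\<theta> \<bullet> y + c) \<partial>\<mu> n) \<longlonglongrightarrow> (\<integral>y. cos (\<theta> \<bullet> y + c) \<partial>G)"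
  shows "converges_weakly \<mu> G"
  unfolding converges_weakly_def
proof (intro allI impI, elim conjE)
  fix f :: "'a \<Rightarrow> real"
  assume f: "continuous_on UNIV f" and "bounded (range f)"
  then obtain B where B: "\<And>y. \<bar>f y\<bar> \<le> B" by (auto simp: bounded_iff)
  have B0: "B \<ge> 0" using B[of 0] by linarith
  have trig: "(\<lambda>n. integral\<^sup>L (\<mu> n) g) \<longlonglongrightarrow> integral\<^sup>L G g" if "trig_poly g" for g
    using that
  proof induction
    case (wave b \<theta> c)
    show ?case using tendsto_mult_left[OF cos] by simp
  next
    case (add f g)
    have i: "integrable M f \<and> integrable M g" if "prob_space M" "sets M = sets borel" for M
      using integrable_continuous_bounded[OF that] trig_poly_bounded[OF add(1)] trig_poly_bounded[OF add(2)]
        trig_poly_continuous[OF add(1)] trig_poly_continuous[OF add(2)] by blast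
    show ?case using tendsto_add[OF add(3,4)] i \<mu> G by simp
  qed
  show "(\<lambda>n. \<integral>y. f y \<partial>\<mu> n) \<longlonglongrightarrow> (\<integral>y. f y \<partial>G)"
  proof (rule LIMSEQ_I)
    fix r :: real assume r: "r > 0"
    define e where "e = min 1 (r / (4 * B + 8))"
    have e: "e > 0" "e \<le> 1" "(4 * B + 8) * e \<le> r"
    proof -
      show "e > 0" "e \<le> 1" using r B0 by (auto simp: e_def)
      have "(4 * B + 8) * e \<le> (4 * B + 8) * (r / (4 * B + 8))"
        using B0 by (intro mult_left_mono) (auto simp: e_def)
      then show "(4 * B + 8) * e \<le> r" using B0 by simp
    qed
    obtain R1 where R1: "\<And>n. measure (\<mu> n) {y. norm y > R1} \<le> e" using tight[OF e(1)] by blast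
    obtain R2 where R2: "measure G {y. norm y > R2} \<le> e" using tail_le[OF G e(1)] by blast
    define R where "R = max R1 R2"
    obtain g where g: "trig_poly g" "\<And>y. norm y \<le> R \<Longrightarrow> \<bar>f y - g y\<bar> \<le> e" "\<And>y. \<bar>g y\<bar> \<le> B + e"
      using trig_poly_approximation[OF f B e(1)] by blast
    have est: "\<bar>integral\<^sup>L M f - integral\<^sup>L M g\<bar> \<le> (2 * B + 2) * e"
      if M: "prob_space M" "sets M = sets borel" and T: "measure M {y. norm y > R'} \<le> e" and "R' \<le> R" for M R'
    proof -
      interpret prob_space M by fact
      have "measure M {y. norm y > R} \<le> measure M {y. norm y > R'}"
        using \<open>R' \<le> R\<close> by (intro finite_measure_mono) (auto simp: M(2) borel_open open_Collect_less)
      then have "measure M {y. norm y > R} \<le> e" using T by simp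
      moreover have "\<bar>integral\<^sup>L M f - integral\<^sup>L M g\<bar> \<le> e + (B + (B + e)) * measure M {y. norm y > R}"
        using g B f trig_poly_continuous e by (intro integral_diff_le_tail[OF M]) auto
      ultimately have "\<bar>integral\<^sup>L M f - integral\<^sup>L M g\<bar> \<le> e + (B + (B + 1)) * e"
        using e B0 by (smt (verit) mult_mono measure_nonneg)
      then show ?thesis by (simp add: algebra_simps)
    qed
    from LIMSEQ_D[OF trig[OF g(1)] e(1)] obtain N where
      N: "\<And>n. n \<ge> N \<Longrightarrow> \<bar>integral\<^sup>L (\<mu> n) g - integral\<^sup>L G g\<bar> < e" by auto
    have "\<bar>integral\<^sup>L (\<mu> n) f - integral\<^sup>L G f\<bar> < r" if "n \<ge> N" for n
    proof -
      have "\<bar>integral\<^sup>L (\<mu> n) f - integral\<^sup>L (\<mu> n) g\<bar> \<le> (2 * B + 2) * e"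
        "\<bar>integral\<^sup>L G f - integral\<^sup>L G g\<bar> \<le> (2 * B + 2) * e"
        using est[OF \<mu> R1] est[OF G R2] by (auto simp: R_def)
      moreover have "(4 * B + 8) * e = 2 * ((2 * B + 2) * e) + 4 * e" by (simp add: algebra_simps)
      ultimately show ?thesis using N[OF that] e by linarith
    qed
    then show "\<exists>N. \<forall>n\<ge>N. norm (integral\<^sup>L (\<mu> n) f - integral\<^sup>L G f) < r" by auto
  qed
qed

section \<open>The Poisson equation and the limiting variance\<close>

text \<open>
  By linearity, \<open>h\<close> solves the Poisson equation for every right-hand side: the potential \<open>w v* h\<close>
  satisfies \<open>q (w v* h) = \<nu>(w) - w\<close>. This provides both correctors below.
\<close>
lemma weighted_poisson_solution:
  fixes w :: "real ^ 'd"
  assumes "poisson_solution q \<nu> h"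
  shows "(\<Sum>j\<in>UNIV - {i}. q $ i $ j * ((w v* h) $ j - (w v* h) $ i)) = w \<bullet> \<nu> - w $ i"
proof -
  have "(\<Sum>j\<in>UNIV - {i}. q $ i $ j * ((w v* h) $ j - (w v* h) $ i))
      = (\<Sum>j\<in>UNIV - {i}. \<Sum>k\<in>UNIV. w $ k * (q $ i $ j * (h $ k $ j - h $ k $ i)))"
    by (intro sum.cong refl)
      (simp add: vector_matrix_mult_def sum_distrib_left flip: sum_subtractf,
        intro sum.cong refl, simp add: algebra_simps)
  also have "\<dots> = (\<Sum>k\<in>UNIV. w $ k * (\<Sum>j\<in>UNIV - {i}. q $ i $ j * (h $ k $ j - h $ k $ i)))"
    by (subst sum.swap) (simp add: sum_distrib_left)
  also have "\<dots> = (\<Sum>k\<in>UNIV. w $ k * (\<nu> $ k - (if i = k then 1 else 0)))"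
    using assms by (simp add: poisson_solution_def)
  also have "\<dots> = w \<bullet> \<nu> - w $ i"
    by (simp add: inner_vec_def right_diff_distrib sum_subtractf if_distrib[of "(*) _"] sum.delta' cong: if_cong)
  finally show ?thesis .
qed

lemma Sigma01_quadratic_form:
  fixes \<theta> :: "real ^ 'd"
  shows "\<theta> \<bullet> (Sigma01 q \<nu> h *v \<theta>)
    = (\<Sum>i\<in>UNIV. \<Sum>j\<in>UNIV. \<nu> $ i * q $ i $ j / 2 * ((\<theta> v* h) $ j - (\<theta> v* h) $ i)\<^sup>2)"
proof -
  let ?d = "\<lambda>i j k. h $ k $ j - h $ k $ i"
  let ?c = "\<lambda>i j. \<nu> $ i * q $ i $ j / 2"
  have d: "(\<theta> v* h) $ j - (\<theta> v* h) $ i = (\<Sum>k\<in>UNIV. \<theta> $ k * ?d i j k)" for i j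
    by (simp add: vector_matrix_mult_def algebra_simps flip: sum_subtractf)
  have "\<theta> \<bullet> (Sigma01 q \<nu> h *v \<theta>)
      = (\<Sum>k\<in>UNIV. \<Sum>l\<in>UNIV. \<Sum>i\<in>UNIV. \<Sum>j\<in>UNIV. ?c i j * ((\<theta> $ k * ?d i j k) * (\<theta> $ l * ?d i j l)))"
    by (simp add: inner_vec_def matrix_vector_mult_def Sigma01_def sum_distrib_left sum_distrib_right mult_ac)
  also have "\<dots> = (\<Sum>k\<in>UNIV. \<Sum>i\<in>UNIV. \<Sum>j\<in>UNIV. \<Sum>l\<in>UNIV. ?c i j * ((\<theta> $ k * ?d i j k) * (\<theta> $ l * ?d i j l)))"
    by (subst (2) sum.swap, subst (3) sum.swap) rule
  also have "\<dots> = (\<Sum>i\<in>UNIV. \<Sum>j\<in>UNIV. \<Sum>k\<in>UNIV. \<Sum>l\<in>UNIV. ?c i j * ((\<theta> $ k * ?d i j k) * (\<theta> $ l * ?d i j l)))"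
    by (subst sum.swap, subst (2) sum.swap) rule
  also have "\<dots> = (\<Sum>i\<in>UNIV. \<Sum>j\<in>UNIV. ?c i j * ((\<theta> v* h) $ j - (\<theta> v* h) $ i)\<^sup>2)"
    by (intro sum.cong refl) (simp only: d power2_eq_square sum_product, simp only: sum_distrib_left)
  finally show ?thesis .
qed

lemma Sigma01_quadratic_form_nonneg:
  assumes "rate_matrix q" "\<nu> \<in> prob_simplex"
  shows "0 \<le> \<theta> \<bullet> (Sigma01 q \<nu> h *v \<theta>)"
  unfolding Sigma01_quadratic_form
proof (intro sum_nonneg)
  fix i j
  show "0 \<le> \<nu> $ i * q $ i $ j / 2 * ((\<theta> v* h) $ j - (\<theta> v* h) $ i)\<^sup>2"
    using assms by (cases "i = j") (auto simp: rate_matrix_def prob_simplex_def)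
qed

text \<open>
  The integral of the carre du champ of the potential \<open>H = \<theta> v* h\<close> is \<open>- 2 \<nu>(H q H)\<close>: expand the square
  and use that the rows of \<open>q\<close> sum to zero and that \<open>\<nu>\<close> is invariant. The Poisson equation then
  replaces \<open>q H\<close>. In this form the variance is the \<open>\<nu>\<close>-mean of the second-order term that the first
  corrector produces.
\<close>
lemma Sigma01_quadratic_form_poisson:
  fixes \<theta> :: "real ^ 'd"
  assumes q: "rate_matrix q" and \<nu>: "\<nu> v* q = 0" and h: "poisson_solution q \<nu> h"
  shows "\<theta> \<bullet> (Sigma01 q \<nu> h *v \<theta>) = (\<Sum>i\<in>UNIV. \<nu> $ i * ((\<theta> v* h) $ i * (\<theta> $ i - \<theta> \<bullet> \<nu>)))"
proof -
  define H where "H = (\<lambda>i. (\<theta> v* h) $ i)"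
  have row: "(\<Sum>j\<in>UNIV. q $ i $ j) = 0" for i
    using q by (simp add: rate_matrix_def sum.remove[of UNIV i])
  have col: "(\<Sum>i\<in>UNIV. \<nu> $ i * q $ i $ j) = 0" for j
    using \<nu> by (simp add: vec_eq_iff vector_matrix_mult_def mult.commute)
  have QH: "(\<Sum>j\<in>UNIV. q $ i $ j * H j) = \<theta> \<bullet> \<nu> - \<theta> $ i" for i
  proof -
    have "(\<Sum>j\<in>UNIV. q $ i $ j * H j) = (\<Sum>j\<in>UNIV. q $ i $ j * (H j - H i))"
      using row[of i] by (simp add: right_diff_distrib sum_subtractf flip: sum_distrib_right)
    also have "\<dots> = (\<Sum>j\<in>UNIV - {i}. q $ i $ j * (H j - H i))"
      by (subst sum.remove[of UNIV i]) auto
    finally show ?thesis using weighted_poisson_solution[OF h] by (simp add: H_def)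
  qed
  have "\<theta> \<bullet> (Sigma01 q \<nu> h *v \<theta>) = (\<Sum>i\<in>UNIV. \<Sum>j\<in>UNIV.
      (\<nu> $ i * q $ i $ j) * ((H j)\<^sup>2 / 2) + (\<nu> $ i * (H i)\<^sup>2 / 2) * q $ i $ j - (\<nu> $ i * H i) * (q $ i $ j * H j))"
    unfolding Sigma01_quadratic_form H_def[symmetric]
    by (intro sum.cong refl) (simp add: power2_eq_square field_simps)
  also have "\<dots> = (\<Sum>i\<in>UNIV. \<Sum>j\<in>UNIV. (\<nu> $ i * q $ i $ j) * ((H j)\<^sup>2 / 2))
      + (\<Sum>i\<in>UNIV. (\<nu> $ i * (H i)\<^sup>2 / 2) * (\<Sum>j\<in>UNIV. q $ i $ j))
      - (\<Sum>i\<in>UNIV. (\<nu> $ i * H i) * (\<Sum>j\<in>UNIV. q $ i $ j * H j))"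
    by (simp add: sum.distrib sum_subtractf sum_distrib_left)
  also have "(\<Sum>i\<in>UNIV. \<Sum>j\<in>UNIV. (\<nu> $ i * q $ i $ j) * ((H j)\<^sup>2 / 2)) = 0"
    by (subst sum.swap) (simp add: col flip: sum_distrib_right sum_divide_distrib)
  finally show ?thesis
    unfolding row QH by (simp add: H_def algebra_simps sum_subtractf)
qed

section \<open>Fluctuations in a fixed direction\<close>

lemma norm_prob_simplex_le: "x \<in> prob_simplex \<Longrightarrow> norm x \<le> 1"
  using norm_le_l1_cart[of x] by (auto simp: prob_simplex_def)

lemma abs_inner_axis_diff_le:
  "x \<in> prob_simplex \<Longrightarrow> \<bar>\<theta> \<bullet> (axis i 1 - x)\<bar> \<le> 2 * norm (\<theta> :: real^'d)"
proof -
  assume x: "x \<in> prob_simplex"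
  have "\<bar>\<theta> \<bullet> (axis i 1 - x)\<bar> \<le> norm \<theta> * norm (axis i 1 - x)" by (rule Cauchy_Schwarz_ineq2)
  also have "\<dots> \<le> norm \<theta> * 2"
    using norm_triangle_ineq4[of "axis i 1 :: real^'d" x] norm_prob_simplex_le[OF x]
    by (intro mult_left_mono) (auto simp: norm_axis_1)
  finally show ?thesis by simp
qed

text \<open>
  One member of the sequence. The index \<open>n\<close> is left out because all the estimates are explicit in \<open>a\<close>,
  with constants that depend only on \<open>\<nu>\<close>, \<open>h\<close> and the direction \<open>\<theta>\<close>.
\<close>
locale stationary_switching =
  fixes q h :: "real ^ 'd ^ 'd" and \<nu> :: "real ^ 'd" and a :: real
    and P :: "real \<Rightarrow> (real ^ 'd) \<times> 'd \<Rightarrow> ((real ^ 'd) \<times> 'd) measure"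
    and \<pi> :: "((real ^ 'd) \<times> 'd) measure"
  assumes rate: "rate_matrix q"
    and simplex: "\<nu> \<in> prob_simplex" and invariant: "\<nu> v* q = 0"
    and a_pos: "a > 0"
    and semigroup: "markov_semigroup state_space P"
    and generator: "has_generator P (switching_generator a q)"
    and stationary: "stationary_distribution state_space P \<pi>"
    and poisson: "poisson_solution q \<nu> h"
begin

definition fluctuation :: "real ^ 'd \<Rightarrow> real ^ 'd \<Rightarrow> real" where
  "fluctuation \<theta> x = sqrt a * (\<theta> \<bullet> (x - \<nu>))"

lemma \<pi>_space: "\<pi> \<in> space (prob_algebra state_space)"
  using stationary by (simp add: stationary_distribution_def)

lemma sets_\<pi>: "sets \<pi> = sets state_space" and prob_\<pi>: "prob_space \<pi>"
  using \<pi>_space by (auto simp: space_prob_algebra)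

lemma space_\<pi>: "space \<pi> = prob_simplex \<times> UNIV"
  using sets_eq_imp_space_eq[OF sets_\<pi>] by (simp add: space_state_space)

sublocale prob_space \<pi> by (rule prob_\<pi>)

lemma continuous_fluctuation [continuous_intros]:
  "continuous_on S f \<Longrightarrow> continuous_on S (\<lambda>x. fluctuation \<theta> (f x))"
  unfolding fluctuation_def by (intro continuous_intros)

lemmas integrable_\<pi> = integrable_fibrewise_continuous[OF \<pi>_space]

text \<open>
  On functions of the rescaled fluctuation \<open>u\<close> in direction \<open>\<theta>\<close> and of the discrete state, the generator
  acts through one real variable. The factor \<open>\<theta> \<bullet> (e\<^sub>i - x)\<close> of the transport term is kept as it stands: it
  is bounded on the simplex, which is how the remainders are controlled.
\<close>
lemma integral_switching_along_direction:
  assumes g: "\<And>i u. (g i has_real_derivative g' i u) (at u)"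
    and g': "\<And>i. continuous_on UNIV (g' i)"
  shows "(\<integral>z. sqrt a * g' (snd z) (fluctuation \<theta> (fst z)) * (\<theta> \<bullet> (axis (snd z) 1 - fst z)) +
      a * (\<Sum>j\<in>UNIV - {snd z}. q $ (snd z) $ j * (g j (fluctuation \<theta> (fst z)) - g (snd z) (fluctuation \<theta> (fst z)))) \<partial>\<pi>) = 0"
proof -
  define f where "f = (\<lambda>z. g (snd z) (fluctuation \<theta> (fst z)))"
  have gd: "GDERIV (\<lambda>y. f (y, i)) x :> (sqrt a * g' i (fluctuation \<theta> x)) *\<^sub>R \<theta>" for i x
  proof -
    have "GDERIV (fluctuation \<theta>) x :> sqrt a *\<^sub>R \<theta>"
      unfolding gderiv_def fluctuation_def by (auto intro!: derivative_eq_intros simp: inner_commute)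
    from GDERIV_DERIV_compose[OF this g] show ?thesis
      by (simp add: f_def mult.commute)
  qed
  have gr: "grad (\<lambda>y. f (y, i)) = (\<lambda>x. (sqrt a * g' i (fluctuation \<theta> x)) *\<^sub>R \<theta>)" for i
    using gd by (intro ext grad_eq)
  have gc: "continuous_on UNIV (g i)" for i
    using g by (intro continuous_at_imp_continuous_on) (auto intro: DERIV_isCont)
  have c1: "continuous_on UNIV (\<lambda>x. g' i (fluctuation \<theta> x))" and c2: "continuous_on UNIV (\<lambda>x. g i (fluctuation \<theta> x))" for i
    by (rule continuous_on_compose2[OF g'] continuous_on_compose2[OF gc]; intro continuous_intros subset_UNIV)+
  have C1: "C1_test_function f"
    unfolding C1_test_function_def gr using gd by (auto intro!: continuous_intros c1)
  have L: "switching_generator a q f = (\<lambda>z. sqrt a * g' (snd z) (fluctuation \<theta> (fst z)) * (\<theta> \<bullet> (axis (snd z) 1 - fst z)) +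
      a * (\<Sum>j\<in>UNIV - {snd z}. q $ (snd z) $ j * (g j (fluctuation \<theta> (fst z)) - g (snd z) (fluctuation \<theta> (fst z)))))"
    unfolding switching_generator_def gr by (auto simp: fun_eq_iff f_def inner_commute)
  show ?thesis
    by (rule stationary_integral_generator_eq_0[OF semigroup generator stationary C1, unfolded L])
      (auto intro!: continuous_intros c1 c2)
qed

text \<open>
  Take \<open>g\<^sub>i(u) = u\<^sup>2 / 2 + H\<^sub>i u / sqrt a\<close> in the stationarity identity. The corrector, with
  \<open>H = \<theta> v* h\<close>, cancels the term of order \<open>sqrt a\<close>; what remains is
  \<open>E[u\<^sup>2] = E[H\<^sub>I \<theta> \<bullet> (e\<^sub>I - X)]\<close>, whose right-hand side is bounded uniformly in \<open>a\<close>.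
\<close>
lemma second_moment_fluctuation:
  "(\<integral>z. (fluctuation \<theta> (fst z))\<^sup>2 \<partial>\<pi>) \<le> (\<Sum>i\<in>UNIV. \<bar>(\<theta> v* h) $ i\<bar>) * (2 * norm \<theta>)"
proof -
  define H where "H = (\<lambda>i. (\<theta> v* h) $ i)"
  define r where "r = sqrt a"
  define K where "K = (\<lambda>i. H i / r)"
  have r: "r > 0" "r * r = a" using a_pos by (auto simp: r_def)
  let ?u = "\<lambda>z. fluctuation \<theta> (fst z)" and ?t = "\<lambda>z. \<theta> \<bullet> (axis (snd z) 1 - fst z)"
  have i1: "integrable \<pi> (\<lambda>z. (?u z)\<^sup>2)" and i2: "integrable \<pi> (\<lambda>z. H (snd z) * ?t z)"
    by (intro integrable_\<pi>; simp; intro continuous_intros)+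
  have gd: "((\<lambda>u. u\<^sup>2 / 2 + K i * u) has_real_derivative u + K i) (at u)" for i u
    by (auto intro!: derivative_eq_intros)
  have gc: "continuous_on UNIV (\<lambda>u. u + K i)" for i by (auto intro!: continuous_intros)
  have "0 = (\<integral>z. r * (?u z + K (snd z)) * ?t z +
      a * (\<Sum>j\<in>UNIV - {snd z}. q $ (snd z) $ j *
        (((?u z)\<^sup>2 / 2 + K j * ?u z) - ((?u z)\<^sup>2 / 2 + K (snd z) * ?u z))) \<partial>\<pi>)"
    by (rule integral_switching_along_direction[where g = "\<lambda>i u. u\<^sup>2 / 2 + K i * u" and \<theta> = \<theta>,
        OF gd gc, folded r_def, symmetric])
  also have "\<dots> = (\<integral>z. H (snd z) * ?t z - (?u z)\<^sup>2 \<partial>\<pi>)"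
  proof (rule Bochner_Integration.integral_cong[OF refl])
    fix z :: "(real^'d) \<times> 'd"
    define x i where "x = fst z" and "i = snd z"
    define u where "u = fluctuation \<theta> x"
    \<comment> \<open>Only the corrector is moved by the jumps, and the Poisson equation evaluates its increments.\<close>
    have "(\<Sum>j\<in>UNIV - {i}. q $ i $ j * ((u\<^sup>2 / 2 + K j * u) - (u\<^sup>2 / 2 + K i * u)))
        = (\<Sum>j\<in>UNIV - {i}. q $ i $ j * (H j - H i)) * (u / r)"
      unfolding sum_distrib_right by (intro sum.cong refl) (simp add: K_def diff_divide_distrib algebra_simps)
    also have "\<dots> = (\<theta> \<bullet> \<nu> - \<theta> $ i) * (u / r)"
      unfolding H_def weighted_poisson_solution[OF poisson] ..
    finally have s: "(\<Sum>j\<in>UNIV - {i}. q $ i $ j * ((u\<^sup>2 / 2 + K j * u) - (u\<^sup>2 / 2 + K i * u)))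
      = (\<theta> \<bullet> \<nu> - \<theta> $ i) * (u / r)" .
    have t: "\<theta> \<bullet> (axis i 1 - x) = \<theta> $ i - \<theta> \<bullet> \<nu> - u / r"
      using r by (simp add: u_def fluctuation_def r_def inner_diff_right inner_axis)
    have "r * (u + K i) * (\<theta> \<bullet> (axis i 1 - x)) + a * ((\<theta> \<bullet> \<nu> - \<theta> $ i) * (u / r))
        = H i * (\<theta> \<bullet> (axis i 1 - x)) - u\<^sup>2"
      unfolding t r(2)[symmetric] K_def using r(1) by (simp add: field_simps power2_eq_square)
    then show "r * (?u z + K (snd z)) * ?t z +
      a * (\<Sum>j\<in>UNIV - {snd z}. q $ (snd z) $ j *
        (((?u z)\<^sup>2 / 2 + K j * ?u z) - ((?u z)\<^sup>2 / 2 + K (snd z) * ?u z)))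
      = H (snd z) * ?t z - (?u z)\<^sup>2"
      unfolding s[symmetric] by (simp add: u_def x_def i_def)
  qed
  also have "\<dots> = (\<integral>z. H (snd z) * ?t z \<partial>\<pi>) - (\<integral>z. (?u z)\<^sup>2 \<partial>\<pi>)" using i1 i2 by simp
  finally have "(\<integral>z. (?u z)\<^sup>2 \<partial>\<pi>) = (\<integral>z. H (snd z) * ?t z \<partial>\<pi>)" by simp
  also have "\<dots> \<le> (\<Sum>i\<in>UNIV. \<bar>H i\<bar>) * (2 * norm \<theta>)"
  proof (rule integral_le_const[OF i2], rule AE_I2)
    fix z assume "z \<in> space \<pi>"
    then have "\<bar>?t z\<bar> \<le> 2 * norm \<theta>" by (intro abs_inner_axis_diff_le) (auto simp: space_\<pi>)
    moreover have "\<bar>H (snd z)\<bar> \<le> (\<Sum>i\<in>UNIV. \<bar>H i\<bar>)" by (rule member_le_sum) auto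
    ultimately have "\<bar>H (snd z)\<bar> * \<bar>?t z\<bar> \<le> (\<Sum>i\<in>UNIV. \<bar>H i\<bar>) * (2 * norm \<theta>)"
      by (intro mult_mono) (auto intro: sum_nonneg)
    then show "H (snd z) * ?t z \<le> (\<Sum>i\<in>UNIV. \<bar>H i\<bar>) * (2 * norm \<theta>)"
      unfolding abs_mult[symmetric] by (rule order_trans[OF abs_ge_self])
  qed
  finally show ?thesis by (simp add: H_def)
qed

end

section \<open>Convergence of the characteristic functions\<close>

lemma abs_cos_add_taylor: "\<bar>cos (y + d) - cos y + d * sin y\<bar> \<le> d\<^sup>2 / 2" for y d :: real
proof -
  have "cos (y + d) - cos y + d * sin y = Re (iexp y * (iexp d - (\<Sum>k\<le>1. (\<i> * d) ^ k / fact k)))"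
    by (simp add: cos_add Re_exp Im_exp algebra_simps)
  also have "\<bar>\<dots>\<bar> \<le> cmod (iexp y * (iexp d - (\<Sum>k\<le>1. (\<i> * d) ^ k / fact k)))"
    by (rule abs_Re_le_cmod)
  also have "\<dots> \<le> d\<^sup>2 / 2"
    using iexp_approx1[of d 1] by (simp add: norm_mult power2_eq_square)
  finally show ?thesis .
qed

text \<open>
  Differentiation under the expectation: the second-order Taylor bound on the cosine makes the
  remainder of the difference quotient at most \<open>\<bar>t\<bar> E[X\<^sup>2] / 2\<close>.
\<close>
lemma (in prob_space) DERIV_expectation_cos:
  assumes [measurable]: "X \<in> borel_measurable M" and X2: "integrable M (\<lambda>x. (X x)\<^sup>2)"
  shows "((\<lambda>s. expectation (\<lambda>x. cos (s * X x + c))) has_real_derivative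
     - expectation (\<lambda>x. X x * sin (s * X x + c))) (at s)"
proof -
  have X1: "integrable M X" by (rule square_integrable_imp_integrable[OF _ X2]) simp
  have C: "integrable M (\<lambda>x. cos (s * X x + c))" for s
    by (rule integrable_const_bound[of _ 1]) auto
  have S: "integrable M (\<lambda>x. X x * sin (s * X x + c))"
    by (rule Bochner_Integration.integrable_bound[OF X1]) (auto simp: abs_mult mult_left_le)
  let ?m = "\<lambda>s. expectation (\<lambda>x. cos (s * X x + c))" and ?D = "expectation (\<lambda>x. X x * sin (s * X x + c))"
  let ?V = "expectation (\<lambda>x. (X x)\<^sup>2)"
  have est: "\<bar>?m (s + t) - ?m s + t * ?D\<bar> \<le> t\<^sup>2 * (?V / 2)" for t
  proof -
    have "\<bar>?m (s + t) - ?m s + t * ?D\<bar>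
        = \<bar>expectation (\<lambda>x. cos ((s + t) * X x + c) - cos (s * X x + c) + t * (X x * sin (s * X x + c)))\<bar>"
      using C S by simp
    also have "\<dots> \<le> expectation (\<lambda>x. \<bar>cos ((s + t) * X x + c) - cos (s * X x + c) + t * (X x * sin (s * X x + c))\<bar>)"
      by simp
    also have "\<dots> \<le> expectation (\<lambda>x. t\<^sup>2 / 2 * (X x)\<^sup>2)"
    proof (rule integral_mono)
      fix x
      show "\<bar>cos ((s + t) * X x + c) - cos (s * X x + c) + t * (X x * sin (s * X x + c))\<bar> \<le> t\<^sup>2 / 2 * (X x)\<^sup>2"
        using abs_cos_add_taylor[of "s * X x + c" "t * X x"]
        by (simp add: algebra_simps power_mult_distrib)
    qed (use C S X2 in auto)
    finally show ?thesis by simp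
  qed
  have "((\<lambda>t. (?m (s + t) - ?m s) / t - (- ?D)) \<longlongrightarrow> 0) (at 0)"
  proof (rule Lim_null_comparison)
    show "\<forall>\<^sub>F t in at 0. norm ((?m (s + t) - ?m s) / t - (- ?D)) \<le> \<bar>t\<bar> * (?V / 2)"
    proof (rule eventually_mono[OF eventually_neq_at_within[of 0]])
      fix t :: real assume t: "t \<noteq> 0"
      have "(?m (s + t) - ?m s) / t - (- ?D) = (?m (s + t) - ?m s + t * ?D) / t"
        using t by (simp add: field_simps)
      also have "norm \<dots> \<le> t\<^sup>2 * (?V / 2) / \<bar>t\<bar>"
        unfolding real_norm_def abs_divide by (intro divide_right_mono est) auto
      also have "\<dots> = \<bar>t\<bar> * (?V / 2)" using t by (simp add: power2_eq_square divide_simps)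
      finally show "norm ((?m (s + t) - ?m s) / t - (- ?D)) \<le> \<bar>t\<bar> * (?V / 2)" .
    qed
    show "((\<lambda>t. \<bar>t\<bar> * (?V / 2)) \<longlongrightarrow> 0) (at 0)"
      by (auto intro!: tendsto_eq_intros)
  qed
  then show ?thesis unfolding DERIV_def by (rule LIM_zero_cancel)
qed

text \<open>
  The state-dependent second-order coefficient left over by the first corrector; its \<open>\<nu>\<close>-mean is the
  limiting variance in direction \<open>\<theta>\<close>, by \<open>Sigma01_quadratic_form_poisson\<close>.
\<close>
definition local_variance :: "real ^ 'd \<Rightarrow> real ^ 'd ^ 'd \<Rightarrow> real ^ 'd \<Rightarrow> real ^ 'd" where
  "local_variance \<nu> h \<theta> = (\<chi> i. (\<theta> v* h) $ i * (\<theta> $ i - \<theta> \<bullet> \<nu>))"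

text \<open>
  The error constant of the approximate Stein identity. The first term bounds \<open>E \<bar>H\<^sub>I u\<bar>\<close> through
  \<open>\<bar>u\<bar> \<le> (1 + u\<^sup>2) / 2\<close> and the bound on \<open>E[u\<^sup>2]\<close>, the second one bounds
  \<open>E \<bar>G\<^sub>I \<theta> \<bullet> (e\<^sub>I - X)\<bar>\<close> for the potential \<open>G\<close> of \<open>local_variance\<close>.
\<close>
definition cos_error :: "real ^ 'd \<Rightarrow> real ^ 'd ^ 'd \<Rightarrow> real ^ 'd \<Rightarrow> real" where
  "cos_error \<nu> h \<theta> =
     (\<Sum>i\<in>UNIV. \<bar>(\<theta> v* h) $ i\<bar>) * ((1 + (\<Sum>i\<in>UNIV. \<bar>(\<theta> v* h) $ i\<bar>) * (2 * norm \<theta>)) / 2) +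
     (\<Sum>i\<in>UNIV. \<bar>(local_variance \<nu> h \<theta> v* h) $ i\<bar>) * (2 * norm \<theta>)"

context stationary_switching begin

text \<open>
  The approximate Stein identity \<open>E[u \<psi>'(u)] = \<sigma>\<^sup>2 E[\<psi>''(u)] + O(1 / sqrt a)\<close> for
  \<open>\<psi>(u) = cos (s u + c) / s\<close>. It is the stationarity identity for
  \<open>g\<^sub>i = \<psi> + H\<^sub>i \<psi>' / sqrt a + G\<^sub>i \<psi>'' / a\<close>: the corrector \<open>H\<close> cancels the term of order \<open>sqrt a\<close> and
  creates \<open>H\<^sub>I (\<theta>\<^sub>I - \<theta> \<bullet> \<nu>) \<psi>''\<close>, and the corrector \<open>G\<close> replaces this coefficient by its \<open>\<nu>\<close>-mean
  \<open>\<sigma>\<^sup>2\<close>. Dividing by \<open>s\<close> in \<open>\<psi>\<close> keeps the error bounded down to \<open>s = 0\<close>.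
\<close>
lemma stein_identity_cos:
  fixes \<theta> :: "real ^ 'd"
  assumes s: "0 < s" "s \<le> 1"
  defines "\<sigma>2 \<equiv> \<theta> \<bullet> (Sigma01 q \<nu> h *v \<theta>)"
  shows "\<bar>(\<integral>z. fluctuation \<theta> (fst z) * sin (s * fluctuation \<theta> (fst z) + c) \<partial>\<pi>)
      - s * \<sigma>2 * (\<integral>z. cos (s * fluctuation \<theta> (fst z) + c) \<partial>\<pi>)\<bar> \<le> cos_error \<nu> h \<theta> / sqrt a"
proof -
  define H where "H = (\<lambda>i. (\<theta> v* h) $ i)"
  define G where "G = (\<lambda>i. (local_variance \<nu> h \<theta> v* h) $ i)"
  define r where "r = sqrt a"
  \<comment> \<open>\<open>k\<close>, \<open>K\<close> and \<open>L\<close> are the coefficients of \<open>\<psi>\<close> and of the two correctors.\<close>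
  define k where "k = 1 / s"
  define K where "K = (\<lambda>i. H i / r)"
  define L where "L = (\<lambda>i. s * G i / a)"
  have r: "r > 0" "r * r = a" using a_pos by (auto simp: r_def)
  have ks: "k * s = 1" using s by (simp add: k_def)
  let ?u = "\<lambda>z. fluctuation \<theta> (fst z)" and ?t = "\<lambda>z. \<theta> \<bullet> (axis (snd z) 1 - fst z)"
  define g where "g = (\<lambda>i u. k * cos (s * u + c) - K i * sin (s * u + c) - L i * cos (s * u + c))"
  define g' where "g' = (\<lambda>i u. - sin (s * u + c) - K i * s * cos (s * u + c) + L i * s * sin (s * u + c))"
  \<comment> \<open>\<open>E\<close> collects the terms of order \<open>1 / sqrt a\<close>, multiplied by \<open>sqrt a\<close>.\<close>
  define E where "E = (\<lambda>z. s * H (snd z) * ?u z * cos (s * ?u z + c) + s\<^sup>2 * G (snd z) * sin (s * ?u z + c) * ?t z)"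
  have gd: "(g i has_real_derivative g' i u) (at u)" for i u
    unfolding g_def g'_def by (auto intro!: derivative_eq_intros simp: ks algebra_simps)
  have gc: "continuous_on UNIV (g' i)" for i
    unfolding g'_def by (intro continuous_intros)
  have i1: "integrable \<pi> (\<lambda>z. ?u z * sin (s * ?u z + c))"
    and i2: "integrable \<pi> (\<lambda>z. cos (s * ?u z + c))"
    and i3: "integrable \<pi> E"
    and i4: "integrable \<pi> (\<lambda>z. (?u z)\<^sup>2)"
    unfolding E_def by (intro integrable_\<pi>; simp; intro continuous_intros)+
  have \<sigma>2: "local_variance \<nu> h \<theta> \<bullet> \<nu> = \<sigma>2"
    unfolding \<sigma>2_def Sigma01_quadratic_form_poisson[OF rate invariant poisson]
    by (simp add: local_variance_def inner_vec_def mult_ac)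
  have "0 = (\<integral>z. r * g' (snd z) (?u z) * ?t z +
      a * (\<Sum>j\<in>UNIV - {snd z}. q $ (snd z) $ j * (g j (?u z) - g (snd z) (?u z))) \<partial>\<pi>)"
    by (rule integral_switching_along_direction[where g = g and \<theta> = \<theta>,
        OF gd gc, folded r_def, symmetric])
  also have "\<dots> = (\<integral>z. ?u z * sin (s * ?u z + c) - s * \<sigma>2 * cos (s * ?u z + c) + E z / r \<partial>\<pi>)"
  proof (rule Bochner_Integration.integral_cong[OF refl])
    fix z :: "(real^'d) \<times> 'd"
    define x i where "x = fst z" and "i = snd z"
    define u where "u = fluctuation \<theta> x"
    define S C where "S = sin (s * u + c)" and "C = cos (s * u + c)"
    define \<gamma> where "\<gamma> = \<theta> $ i - \<theta> \<bullet> \<nu>"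
    have "(\<Sum>j\<in>UNIV - {i}. q $ i $ j * (g j u - g i u))
        = (\<Sum>j\<in>UNIV - {i}. - (q $ i $ j * (H j - H i)) * (S / r) - (q $ i $ j * (G j - G i)) * (s * C / a))"
      unfolding g_def K_def L_def S_def[symmetric] C_def[symmetric]
      by (intro sum.cong refl) (simp add: diff_divide_distrib algebra_simps)
    also have "\<dots> = - (\<Sum>j\<in>UNIV - {i}. q $ i $ j * (H j - H i)) * (S / r)
        - (\<Sum>j\<in>UNIV - {i}. q $ i $ j * (G j - G i)) * (s * C / a)"
      by (simp only: sum_subtractf sum_distrib_right sum_negf mult_minus_left)
    also have "\<dots> = \<gamma> * (S / r) - (\<sigma>2 - H i * \<gamma>) * (s * C / a)"
      unfolding H_def G_def weighted_poisson_solution[OF poisson] \<sigma>2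
      by (simp add: local_variance_def \<gamma>_def)
    finally have s: "(\<Sum>j\<in>UNIV - {i}. q $ i $ j * (g j u - g i u))
      = \<gamma> * (S / r) - (\<sigma>2 - H i * \<gamma>) * (s * C / a)" .
    have t: "\<theta> \<bullet> (axis i 1 - x) = \<gamma> - u / r"
      using r by (simp add: u_def fluctuation_def r_def inner_diff_right inner_axis \<gamma>_def)
    have "r * g' i u * (\<theta> \<bullet> (axis i 1 - x)) + a * (\<gamma> * (S / r) - (\<sigma>2 - H i * \<gamma>) * (s * C / a))
        = u * S - s * \<sigma>2 * C + (s * H i * u * C + s\<^sup>2 * G i * S * (\<theta> \<bullet> (axis i 1 - x))) / r"
      unfolding t g'_def K_def L_def r(2)[symmetric] S_def[symmetric] C_def[symmetric] using r(1)
      by (simp add: field_simps power2_eq_square)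
    then show "r * g' (snd z) (?u z) * ?t z +
      a * (\<Sum>j\<in>UNIV - {snd z}. q $ (snd z) $ j * (g j (?u z) - g (snd z) (?u z)))
      = ?u z * sin (s * ?u z + c) - s * \<sigma>2 * cos (s * ?u z + c) + E z / r"
      unfolding s[symmetric] by (simp add: E_def u_def x_def i_def S_def C_def)
  qed
  also have "\<dots> = (\<integral>z. ?u z * sin (s * ?u z + c) \<partial>\<pi>) - s * \<sigma>2 * (\<integral>z. cos (s * ?u z + c) \<partial>\<pi>)
      + (\<integral>z. E z \<partial>\<pi>) / r"
    using i1 i2 i3 by simp
  finally have "(\<integral>z. ?u z * sin (s * ?u z + c) \<partial>\<pi>) - s * \<sigma>2 * (\<integral>z. cos (s * ?u z + c) \<partial>\<pi>)
      = - (\<integral>z. E z \<partial>\<pi>) / r" by simp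
  moreover have "\<bar>\<integral>z. E z \<partial>\<pi>\<bar> \<le> cos_error \<nu> h \<theta>"
  proof -
    define A B where "A = (\<Sum>i\<in>UNIV. \<bar>H i\<bar>)" and "B = (\<Sum>i\<in>UNIV. \<bar>G i\<bar>)"
    have AB: "0 \<le> A" "0 \<le> B" by (auto simp: A_def B_def intro: sum_nonneg)
    have AH: "\<bar>H i\<bar> \<le> A" and BG: "\<bar>G i\<bar> \<le> B" for i
      unfolding A_def B_def by (auto intro: member_le_sum)
    have "\<bar>\<integral>z. E z \<partial>\<pi>\<bar> \<le> (\<integral>z. \<bar>E z\<bar> \<partial>\<pi>)" by simp
    also have "\<dots> \<le> (\<integral>z. A * ((1 + (?u z)\<^sup>2) / 2) + B * (2 * norm \<theta>) \<partial>\<pi>)"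
    proof (rule integral_mono)
      fix z assume z: "z \<in> space \<pi>"
      have t: "\<bar>?t z\<bar> \<le> 2 * norm \<theta>" using z by (intro abs_inner_axis_diff_le) (auto simp: space_\<pi>)
      have "0 \<le> (1 - \<bar>?u z\<bar>)\<^sup>2" by simp
      then have u: "\<bar>?u z\<bar> \<le> (1 + (?u z)\<^sup>2) / 2" by (simp add: power2_eq_square algebra_simps)
      have "\<bar>s * H (snd z) * ?u z * cos (s * ?u z + c)\<bar> = (\<bar>s\<bar> * \<bar>cos (s * ?u z + c)\<bar>) * (\<bar>H (snd z)\<bar> * \<bar>?u z\<bar>)"
        by (simp add: abs_mult mult_ac)
      also have "\<dots> \<le> (1 * 1) * (A * ((1 + (?u z)\<^sup>2) / 2))"
        using s AH AB u by (intro mult_mono) auto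
      finally have 1: "\<bar>s * H (snd z) * ?u z * cos (s * ?u z + c)\<bar> \<le> A * ((1 + (?u z)\<^sup>2) / 2)" by simp
      have "\<bar>s\<^sup>2 * G (snd z) * sin (s * ?u z + c) * ?t z\<bar> = (\<bar>s\<^sup>2\<bar> * \<bar>sin (s * ?u z + c)\<bar>) * (\<bar>G (snd z)\<bar> * \<bar>?t z\<bar>)"
        by (simp add: abs_mult mult_ac)
      also have "\<dots> \<le> (1 * 1) * (B * (2 * norm \<theta>))"
        using s BG AB t power_le_one[of s 2] by (intro mult_mono) auto
      finally have 2: "\<bar>s\<^sup>2 * G (snd z) * sin (s * ?u z + c) * ?t z\<bar> \<le> B * (2 * norm \<theta>)" by simp
      show "\<bar>E z\<bar> \<le> A * ((1 + (?u z)\<^sup>2) / 2) + B * (2 * norm \<theta>)"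
        unfolding E_def using abs_triangle_ineq 1 2 by (meson add_mono order_trans)
    qed (use i3 i4 in auto)
    also have "\<dots> = A * ((1 + (\<integral>z. (?u z)\<^sup>2 \<partial>\<pi>)) / 2) + B * (2 * norm \<theta>)"
      using i4 by (simp add: prob_space)
    also have "\<dots> \<le> A * ((1 + A * (2 * norm \<theta>)) / 2) + B * (2 * norm \<theta>)"
      using second_moment_fluctuation[of \<theta>] AB unfolding A_def H_def
      by (intro add_right_mono mult_left_mono divide_right_mono add_left_mono) auto
    finally show ?thesis by (simp add: cos_error_def A_def B_def H_def G_def)
  qed
  ultimately show ?thesis using r(1) by (simp add: r_def divide_right_mono)
qed

text \<open>
  With \<open>m(s) = E[cos (s u + c)]\<close> the Stein identity reads \<open>m'(s) = - s \<sigma>\<^sup>2 m(s) + O(1 / sqrt a)\<close> on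
  \<open>0 < s \<le> 1\<close>, with \<open>m(0) = cos c\<close>. The mean value theorem for the product of \<open>m\<close> with the integrating
  factor \<open>exp (s\<^sup>2 \<sigma>\<^sup>2 / 2)\<close> compares \<open>m(1)\<close> with the Gaussian value.
\<close>
lemma expectation_cos_fluctuation_approx:
  "\<bar>(\<integral>z. cos (fluctuation \<theta> (fst z) + c) \<partial>\<pi>)
      - cos c * exp (- (\<theta> \<bullet> (Sigma01 q \<nu> h *v \<theta>) / 2))\<bar> \<le> cos_error \<nu> h \<theta> / sqrt a"
proof -
  define v where "v = \<theta> \<bullet> (Sigma01 q \<nu> h *v \<theta>)"
  have v: "v \<ge> 0" unfolding v_def by (rule Sigma01_quadratic_form_nonneg[OF rate simplex])
  define e where "e = cos_error \<nu> h \<theta> / sqrt a"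
  let ?u = "\<lambda>z. fluctuation \<theta> (fst z)"
  define m where "m = (\<lambda>s. \<integral>z. cos (s * ?u z + c) \<partial>\<pi>)"
  define I where "I = (\<lambda>s. \<integral>z. ?u z * sin (s * ?u z + c) \<partial>\<pi>)"
  have iu: "integrable \<pi> ?u" and iu2: "integrable \<pi> (\<lambda>z. (?u z)\<^sup>2)"
    by (intro integrable_\<pi>; simp; intro continuous_intros)+
  have dm: "(m has_real_derivative - I s) (at s)" for s
    unfolding m_def I_def using iu iu2 by (intro DERIV_expectation_cos) auto
  have dF: "((\<lambda>s. m s * exp (s\<^sup>2 * v / 2)) has_real_derivative - (I s - s * v * m s) * exp (s\<^sup>2 * v / 2)) (at s)" for s
    by (auto intro!: derivative_eq_intros dm simp: algebra_simps)
  obtain s where s: "0 < s" "s < 1" and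
    eq: "m 1 * exp (1\<^sup>2 * v / 2) - m 0 * exp (0\<^sup>2 * v / 2) = (1 - 0) * (- (I s - s * v * m s) * exp (s\<^sup>2 * v / 2))"
    using MVT2[of 0 1 "\<lambda>s. m s * exp (s\<^sup>2 * v / 2)", OF _ dF] by auto
  have "m 0 = cos c" by (simp add: m_def prob_space)
  then have "(m 1 - cos c * exp (- (v / 2))) * exp (v / 2) = - (I s - s * v * m s) * exp (s\<^sup>2 * v / 2)"
    using eq by (simp add: left_diff_distrib mult.assoc flip: exp_add)
  then have "\<bar>m 1 - cos c * exp (- (v / 2))\<bar> * exp (v / 2) = \<bar>I s - s * v * m s\<bar> * exp (s\<^sup>2 * v / 2)"
    by (metis abs_exp_cancel abs_minus_cancel abs_mult)
  also have "\<dots> \<le> e * exp (v / 2)"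
  proof (rule mult_mono)
    show le: "\<bar>I s - s * v * m s\<bar> \<le> e"
      using stein_identity_cos[of s \<theta> c] s by (simp add: I_def m_def v_def e_def)
    show "exp (s\<^sup>2 * v / 2) \<le> exp (v / 2)" using s v power_le_one[of s 2] by (simp add: mult_left_le_one_le)
    show "0 \<le> e" using le by linarith
  qed simp
  finally have "\<bar>m 1 - cos c * exp (- (v / 2))\<bar> \<le> e" by simp
  then show ?thesis by (simp add: m_def v_def e_def)
qed

end

section \<open>The limiting Gaussian law\<close>

text \<open>
  Writing the law as that of \<open>s Z\<close> with \<open>Z\<close> standard normal treats point masses and densities alike.
\<close>
lemma normal_law_eq_distr:
  assumes "s \<ge> 0"
  shows "normal_law 0 s = distr std_normal_distribution borel (\<lambda>x. s * x)"
proof (cases "s = 0")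
  case True
  interpret real_distribution std_normal_distribution by (rule real_dist_normal_dist)
  show ?thesis by (simp add: normal_law_def True)
next
  case False
  interpret real_distribution std_normal_distribution by (rule real_dist_normal_dist)
  have "distributed std_normal_distribution lborel (\<lambda>x. x) (normal_density 0 1)"
    by (simp add: distributed_def distr_id2)
  from normal_density_affine[OF this, of s 0] False assms
  have "distributed std_normal_distribution lborel (\<lambda>x. s * x) (normal_density 0 s)" by simp
  then have "distr std_normal_distribution lborel (\<lambda>x. s * x) = normal_law 0 s"
    using False by (simp add: distributed_distr_eq_density normal_law_def)
  then show ?thesis by (simp cong: distr_cong)
qed

lemma real_distribution_normal_law: "s \<ge> 0 \<Longrightarrow> real_distribution (normal_law 0 s)"
  using prob_space.real_distribution_distr[OF real_distribution.axioms(1)[OF real_dist_normal_dist], of "\<lambda>x. s * x"]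
  by (simp add: normal_law_eq_distr)

lemma char_distr_scaled_std_normal:
  "char (distr std_normal_distribution borel (\<lambda>x. s * x)) t = exp (- (s * t)\<^sup>2 / 2)"
proof -
  have "char (distr std_normal_distribution borel (\<lambda>x. s * x)) t = char std_normal_distribution (s * t)"
    by (simp add: char_def integral_distr mult_ac)
  then show ?thesis by (simp add: char_std_normal_distribution)
qed

lemma integral_cos_normal_law:
  assumes "s \<ge> 0"
  shows "(\<integral>x. cos (x + c) \<partial>normal_law 0 s) = cos c * exp (- (s\<^sup>2 / 2))"
proof -
  interpret real_distribution "normal_law 0 s" by (rule real_distribution_normal_law[OF assms])
  have i: "integrable (normal_law 0 s) (\<lambda>x. iexp (1 * x))" by (intro integrable_iexp) auto
  have ch: "(\<integral>x. iexp (1 * x) \<partial>normal_law 0 s) = exp (- (s\<^sup>2 / 2))"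
    using char_distr_scaled_std_normal[of s 1] by (simp add: normal_law_eq_distr[OF assms] char_def)
  have C: "(\<integral>x. cos x \<partial>normal_law 0 s) = exp (- (s\<^sup>2 / 2))"
    using integral_Re[OF i] unfolding ch by (simp add: Re_exp)
  have S: "(\<integral>x. sin x \<partial>normal_law 0 s) = 0"
    using integral_Im[OF i] unfolding ch by (simp add: Im_exp)
  have "integrable (normal_law 0 s) cos" "integrable (normal_law 0 s) sin"
    by (auto intro!: integrable_const_bound[of _ 1])
  then show ?thesis by (simp add: cos_add C S)
qed

text \<open>
  The law of \<open>\<Sum>\<^sub>i Z\<^sub>i v\<^sub>i\<close> for independent standard normal \<open>Z\<^sub>i\<close>. Its marginals are identified by their
  characteristic functions, which covers the directions orthogonal to all \<open>v\<^sub>i\<close>, where the law degenerates.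
\<close>
lemma gaussian_sum_of_squares_exists:
  fixes v :: "'i::finite \<Rightarrow> 'a::euclidean_space"
  obtains G where "prob_space G" "sets G = sets borel"
    "\<And>\<theta>. distr G borel (\<lambda>x. \<theta> \<bullet> x) = normal_law 0 (sqrt (\<Sum>i\<in>UNIV. (\<theta> \<bullet> v i)\<^sup>2))"
proof
  define N where "N = PiM UNIV (\<lambda>_::'i. std_normal_distribution)"
  let ?G = "distr N borel (\<lambda>z. \<Sum>i\<in>UNIV. z i *\<^sub>R v i)"
  interpret S: real_distribution std_normal_distribution by (rule real_dist_normal_dist)
  interpret product_prob_space "\<lambda>_::'i. std_normal_distribution" UNIV ..
  interpret N: prob_space N unfolding N_def by (rule P.prob_space_axioms)
  have comp: "(\<lambda>z. z i) \<in> borel_measurable N" for i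
    unfolding N_def using measurable_component_singleton[of i UNIV "\<lambda>_::'i. std_normal_distribution"] by simp
  note comp [measurable]
  show "prob_space ?G" by (rule N.prob_space_distr) simp
  show "sets ?G = sets borel" by simp
  fix \<theta> :: 'a
  let ?X = "\<lambda>i z. z i * (\<theta> \<bullet> v i)"
  have ind0: "N.indep_vars (\<lambda>_. std_normal_distribution) (\<lambda>i z. z i) UNIV"
  proof (subst N.indep_vars_iff_distr_eq_PiM)
    have "distr N (PiM UNIV (\<lambda>_::'i. std_normal_distribution)) (\<lambda>x. \<lambda>i\<in>UNIV. x i) = N"
      by (simp add: N_def distr_id2 restrict_UNIV)
    also have "\<dots> = PiM UNIV (\<lambda>i. distr N std_normal_distribution (\<lambda>z. z i))"
      unfolding N_def by (subst distr_PiM_component) (auto intro: S.prob_space_axioms)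
    finally show "distr N (PiM UNIV (\<lambda>_::'i. std_normal_distribution)) (\<lambda>x. \<lambda>i\<in>UNIV. x i)
      = PiM UNIV (\<lambda>i. distr N std_normal_distribution (\<lambda>z. z i))" .
  qed (auto intro: comp)
  have ind: "N.indep_vars (\<lambda>_. borel) ?X UNIV"
    by (rule N.indep_vars_compose2[OF ind0]) simp
  have marg: "char (distr N borel (?X i)) t = exp (- ((\<theta> \<bullet> v i) * t)\<^sup>2 / 2)" for i t
  proof -
    have "distr N std_normal_distribution (\<lambda>z. z i) = std_normal_distribution"
      unfolding N_def by (subst distr_PiM_component) (auto intro: S.prob_space_axioms)
    then have "distr N borel (\<lambda>z. z i) = std_normal_distribution"
      by (simp cong: distr_cong)
    moreover have "distr N borel (?X i) = distr (distr N borel (\<lambda>z. z i)) borel (\<lambda>x. (\<theta> \<bullet> v i) * x)"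
      by (subst distr_distr) (auto simp: comp_def mult.commute)
    ultimately show ?thesis by (simp add: char_distr_scaled_std_normal)
  qed
  have "distr ?G borel (\<lambda>x. \<theta> \<bullet> x) = distr N borel (\<lambda>z. \<Sum>i\<in>UNIV. ?X i z)"
    by (subst distr_distr) (auto simp: comp_def inner_sum_right)
  also have "\<dots> = normal_law 0 (sqrt (\<Sum>i\<in>UNIV. (\<theta> \<bullet> v i)\<^sup>2))"
  proof (rule Levy_uniqueness)
    have sn: "(\<Sum>i\<in>UNIV. (\<theta> \<bullet> v i)\<^sup>2) \<ge> 0" by (intro sum_nonneg) auto
    show "real_distribution (distr N borel (\<lambda>z. \<Sum>i\<in>UNIV. ?X i z))"
      by (rule N.real_distribution_distr) simp
    show "real_distribution (normal_law 0 (sqrt (\<Sum>i\<in>UNIV. (\<theta> \<bullet> v i)\<^sup>2)))"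
      using sn by (intro real_distribution_normal_law) auto
    show "char (distr N borel (\<lambda>z. \<Sum>i\<in>UNIV. ?X i z)) = char (normal_law 0 (sqrt (\<Sum>i\<in>UNIV. (\<theta> \<bullet> v i)\<^sup>2)))"
    proof
      fix t
      have "char (distr N borel (\<lambda>z. \<Sum>i\<in>UNIV. ?X i z)) t = (\<Prod>i\<in>UNIV. complex_of_real (exp (- ((\<theta> \<bullet> v i) * t)\<^sup>2 / 2)))"
        by (subst N.char_distr_sum[OF ind]) (simp only: marg)
      also have "\<dots> = complex_of_real (exp (\<Sum>i\<in>UNIV. - ((\<theta> \<bullet> v i) * t)\<^sup>2 / 2))"
        by (simp only: exp_sum[OF finite] of_real_prod)
      also have "(\<Sum>i\<in>UNIV. - ((\<theta> \<bullet> v i) * t)\<^sup>2 / 2) = - (sqrt (\<Sum>i\<in>UNIV. (\<theta> \<bullet> v i)\<^sup>2) * t)\<^sup>2 / 2"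
        using sn by (simp add: power_mult_distrib sum_distrib_right sum_divide_distrib sum_negf)
      finally show "char (distr N borel (\<lambda>z. \<Sum>i\<in>UNIV. ?X i z)) t = char (normal_law 0 (sqrt (\<Sum>i\<in>UNIV. (\<theta> \<bullet> v i)\<^sup>2))) t"
        using sn by (simp add: normal_law_eq_distr char_distr_scaled_std_normal)
    qed
  qed
  finally show "distr ?G borel (\<lambda>x. \<theta> \<bullet> x) = normal_law 0 (sqrt (\<Sum>i\<in>UNIV. (\<theta> \<bullet> v i)\<^sup>2))" .
qed

text \<open>
  \<open>Sigma01\<close> is given as a sum of rank-one matrices \<open>v v\<^sup>T\<close> with one vector \<open>v\<close> for each pair of states, so
  the Gaussian is an explicit linear image of independent normals.
\<close>
lemma centered_gaussian_Sigma01_exists: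
  fixes q h :: "real ^ 'd ^ 'd"
  assumes q: "rate_matrix q" and \<nu>: "\<nu> \<in> prob_simplex"
  obtains G where "centered_gaussian (Sigma01 q \<nu> h) G"
proof -
  define v where "v = (\<lambda>(i, j). sqrt (\<nu> $ i * q $ i $ j / 2) *\<^sub>R (\<chi> k. h $ k $ j - h $ k $ i))"
  obtain G where "prob_space G" and "sets G = sets borel" and
    G: "\<And>\<theta>. distr G borel (\<lambda>x. \<theta> \<bullet> x) = normal_law 0 (sqrt (\<Sum>p\<in>UNIV. (\<theta> \<bullet> v p)\<^sup>2))"
    using gaussian_sum_of_squares_exists[of v] by blast
  moreover have "transpose (Sigma01 q \<nu> h) = Sigma01 q \<nu> h"
    by (simp add: transpose_def Sigma01_def vec_eq_iff mult_ac)
  moreover have "0 \<le> \<theta> \<bullet> (Sigma01 q \<nu> h *v \<theta>)" for \<theta>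
    by (rule Sigma01_quadratic_form_nonneg[OF q \<nu>])
  moreover have "distr G borel (\<lambda>x. \<theta> \<bullet> x) = normal_law 0 (sqrt (\<theta> \<bullet> (Sigma01 q \<nu> h *v \<theta>)))" for \<theta>
  proof -
    have *: "(\<theta> \<bullet> v (i, j))\<^sup>2 = \<nu> $ i * q $ i $ j / 2 * ((\<theta> v* h) $ j - (\<theta> v* h) $ i)\<^sup>2" for i j
    proof -
      have d: "\<theta> \<bullet> (\<chi> k. h $ k $ j - h $ k $ i) = (\<theta> v* h) $ j - (\<theta> v* h) $ i"
        by (simp add: inner_vec_def vector_matrix_mult_def algebra_simps flip: sum_subtractf)
      \<comment> \<open>On the diagonal \<open>q\<close> is nonpositive, and squaring does not undo \<open>sqrt\<close>; but there the increment vanishes.\<close>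
      show ?thesis
      proof (cases "i = j")
        case False
        then have "0 \<le> \<nu> $ i * q $ i $ j / 2"
          using q \<nu> by (auto simp: rate_matrix_def prob_simplex_def)
        then show ?thesis by (simp add: v_def d power_mult_distrib)
      qed (simp add: v_def flip: zero_vec_def)
    qed
    have "(\<Sum>p\<in>UNIV. (\<theta> \<bullet> v p)\<^sup>2) = (\<Sum>i\<in>UNIV. \<Sum>j\<in>UNIV. (\<theta> \<bullet> v (i, j))\<^sup>2)"
      by (simp add: sum.cartesian_product)
    also have "\<dots> = \<theta> \<bullet> (Sigma01 q \<nu> h *v \<theta>)"
      unfolding * Sigma01_quadratic_form ..
    finally show ?thesis by (simp add: G)
  qed
  ultimately have "centered_gaussian (Sigma01 q \<nu> h) G" by (simp add: centered_gaussian_def)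
  then show ?thesis by (rule that)
qed

lemma integral_cos_centered_gaussian:
  assumes "centered_gaussian C G"
  shows "(\<integral>y. cos (\<theta> \<bullet> y + c) \<partial>G) = cos c * exp (- (\<theta> \<bullet> (C *v \<theta>) / 2))"
proof -
  have s: "sets G = sets borel" and d: "distr G borel (\<lambda>x. \<theta> \<bullet> x) = normal_law 0 (sqrt (\<theta> \<bullet> (C *v \<theta>)))"
    and nn: "0 \<le> \<theta> \<bullet> (C *v \<theta>)"
    using assms by (auto simp: centered_gaussian_def)
  have "(\<lambda>y. \<theta> \<bullet> y) \<in> borel_measurable G" using s by (simp cong: measurable_cong_sets)
  then have "(\<integral>y. cos (\<theta> \<bullet> y + c) \<partial>G) = (\<integral>x. cos (x + c) \<partial>distr G borel (\<lambda>x. \<theta> \<bullet> x))"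
    by (simp add: integral_distr)
  then show ?thesis using nn by (simp add: d integral_cos_normal_law)
qed

section \<open>The rescaled stationary laws\<close>

context stationary_switching begin

definition rescaled_law :: "(real ^ 'd) measure" where
  "rescaled_law = distr \<pi> borel (\<lambda>(x, i). sqrt a *\<^sub>R (x - \<nu>))"

lemma rescaling_measurable [measurable]: "(\<lambda>(x, i). sqrt a *\<^sub>R (x - \<nu>)) \<in> borel_measurable \<pi>"
proof -
  have "(\<lambda>(x, i). sqrt a *\<^sub>R (x - \<nu>)) \<in> borel_measurable state_space"
    by (rule measurable_fibrewise_continuous) (auto intro!: continuous_intros)
  then show ?thesis by (simp cong: measurable_cong_sets add: sets_\<pi>)
qed

lemma prob_rescaled_law: "prob_space rescaled_law"
  unfolding rescaled_law_def by (rule prob_space_distr) (rule rescaling_measurable)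

lemma sets_rescaled_law: "sets rescaled_law = sets borel"
  by (simp add: rescaled_law_def)

lemma integral_rescaled_law:
  assumes "(f :: real \<Rightarrow> real) \<in> borel_measurable borel"
  shows "(\<integral>y. f (\<theta> \<bullet> y) \<partial>rescaled_law) = (\<integral>z. f (fluctuation \<theta> (fst z)) \<partial>\<pi>)"
  unfolding rescaled_law_def
  by (subst integral_distr[OF rescaling_measurable])
    (use assms in \<open>auto simp: fluctuation_def split_beta\<close>)

text \<open>
  Tightness, uniformly in \<open>a\<close>: the Markov inequality for \<open>\<bar>y\<bar>\<^sup>2\<close> and the second moments in the
  coordinate directions.
\<close>
lemma rescaled_law_tail:
  assumes R: "R > 0"
  shows "measure rescaled_law {y. norm y > R}
    \<le> (\<Sum>k\<in>UNIV. (\<Sum>i\<in>UNIV. \<bar>(axis k 1 v* h) $ i\<bar>) * 2) / R\<^sup>2"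
proof -
  interpret Y: prob_space rescaled_law by (rule prob_rescaled_law)
  have [measurable_cong]: "sets rescaled_law = sets borel" by (rule sets_rescaled_law)
  have n: "(norm y)\<^sup>2 = (\<Sum>k\<in>UNIV. (axis k 1 \<bullet> y)\<^sup>2)" for y :: "real ^ 'd"
    by (simp add: norm_vec_def L2_set_def sum_nonneg inner_axis' )
  have ik: "integrable rescaled_law (\<lambda>y. (axis k 1 \<bullet> y)\<^sup>2)" for k
    unfolding rescaled_law_def
    by (subst integrable_distr_eq[OF rescaling_measurable]; simp?; simp only: split_beta; intro integrable_\<pi>; simp)
      (intro continuous_intros)
  have i: "integrable rescaled_law (\<lambda>y. (norm y)\<^sup>2)"
    unfolding n by (intro Bochner_Integration.integrable_sum ik)
  have "(\<integral>y. (norm y)\<^sup>2 \<partial>rescaled_law) = (\<Sum>k\<in>UNIV. \<integral>z. (fluctuation (axis k 1) (fst z))\<^sup>2 \<partial>\<pi>)"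
    unfolding n by (subst Bochner_Integration.integral_sum[OF ik]) (simp add: integral_rescaled_law[of "\<lambda>x. x\<^sup>2"])
  also have "\<dots> \<le> (\<Sum>k\<in>UNIV. (\<Sum>i\<in>UNIV. \<bar>(axis k 1 v* h) $ i\<bar>) * 2)"
    using second_moment_fluctuation[of "axis _ 1"] by (intro sum_mono) (simp add: norm_axis_1)
  finally have m: "(\<integral>y. (norm y)\<^sup>2 \<partial>rescaled_law) \<le> (\<Sum>k\<in>UNIV. (\<Sum>i\<in>UNIV. \<bar>(axis k 1 v* h) $ i\<bar>) * 2)" .
  have "measure rescaled_law {y. norm y > R} \<le> measure rescaled_law {y \<in> space rescaled_law. R\<^sup>2 \<le> (norm y)\<^sup>2}"
    using R sets_eq_imp_space_eq[OF sets_rescaled_law]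
    by (intro Y.finite_measure_mono) (auto intro!: power_mono)
  also have "\<dots> \<le> (\<integral>y. (norm y)\<^sup>2 \<partial>rescaled_law) / R\<^sup>2"
    using i R by (intro integral_Markov_inequality_measure[where A = "{}"]) auto
  also have "\<dots> \<le> (\<Sum>k\<in>UNIV. (\<Sum>i\<in>UNIV. \<bar>(axis k 1 v* h) $ i\<bar>) * 2) / R\<^sup>2"
    using m by (intro divide_right_mono) auto
  finally show ?thesis .
qed

end

theorem corollary3p9:
  fixes q h :: "real ^ 'd ^ 'd"
    and \<nu> :: "real ^ 'd"
    and a :: "nat \<Rightarrow> real"
    and P :: "nat \<Rightarrow> real \<Rightarrow> (real ^ 'd) \<times> 'd \<Rightarrow> ((real ^ 'd) \<times> 'd) measure"
    and \<pi> :: "nat \<Rightarrow> ((real ^ 'd) \<times> 'd) measure"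
  assumes "rate_matrix q"
    and "irreducible_matrix (mat 1 + q)"
    and "\<nu> \<in> prob_simplex" and "\<nu> v* q = 0"
    and "\<And>n. n \<ge> 1 \<Longrightarrow> a n > 0"
    and "filterlim a at_top sequentially"
    and "\<And>n. n \<ge> 1 \<Longrightarrow> markov_semigroup state_space (P n)"
    and "\<And>n. n \<ge> 1 \<Longrightarrow> has_generator (P n) (switching_generator (a n) q)"
    and "\<And>n. n \<ge> 1 \<Longrightarrow> stationary_distribution state_space (P n) (\<pi> n)"
    and "poisson_solution q \<nu> h"
  shows "\<exists>\<G>. centered_gaussian (Sigma01 q \<nu> h) \<G> \<and>
           converges_weakly
             (\<lambda>n. distr (\<pi> n) borel (\<lambda>(x, i). sqrt (a n) *\<^sub>R (x - \<nu>))) \<G>"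
proof -
  obtain G where G: "centered_gaussian (Sigma01 q \<nu> h) G"
    using centered_gaussian_Sigma01_exists assms(1,3) by metis
  have G': "prob_space G" "sets G = sets borel" using G by (auto simp: centered_gaussian_def)
  define \<mu> where "\<mu> = (\<lambda>n. distr (\<pi> n) borel (\<lambda>(x, i). sqrt (a n) *\<^sub>R (x - \<nu>)))"
  have S: "stationary_switching q h \<nu> (a (Suc n)) (P (Suc n)) (\<pi> (Suc n))" for n
    using assms by unfold_locales auto
  have \<mu>_eq: "\<mu> (Suc n) = stationary_switching.rescaled_law \<nu> (a (Suc n)) (\<pi> (Suc n))" for n
    by (simp add: \<mu>_def stationary_switching.rescaled_law_def[OF S])
  \<comment> \<open>The assumptions start at \<open>n = 1\<close>, hence the shift.\<close>
  have "converges_weakly (\<lambda>n. \<mu> (Suc n)) G"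
  proof (rule converges_weakly_if_tight_and_cos_converge[OF _ _ G'])
    fix n
    show "prob_space (\<mu> (Suc n))" "sets (\<mu> (Suc n)) = sets borel"
      unfolding \<mu>_eq by (rule stationary_switching.prob_rescaled_law[OF S] stationary_switching.sets_rescaled_law[OF S])+
  next
    fix e :: real assume e: "e > 0"
    define T where "T = (\<Sum>k\<in>UNIV. (\<Sum>i\<in>UNIV. \<bar>(axis k 1 v* h) $ i\<bar>) * 2)"
    have T: "T \<ge> 0" unfolding T_def by (intro sum_nonneg) (auto intro: sum_nonneg)
    define R where "R = sqrt (T / e + 1)"
    have R: "R > 0" "T / R\<^sup>2 \<le> e" using T e by (auto simp: R_def field_simps add_pos_nonneg)
    have "measure (\<mu> (Suc n)) {y. norm y > R} \<le> e" for n
      using stationary_switching.rescaled_law_tail[OF S R(1)] R(2) unfolding \<mu>_eq T_def by (meson order_trans)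
    then show "\<exists>R. \<forall>n. measure (\<mu> (Suc n)) {y. norm y > R} \<le> e" by blast
  next
    fix \<theta> :: "real ^ 'd" and c :: real
    let ?l = "cos c * exp (- (\<theta> \<bullet> (Sigma01 q \<nu> h *v \<theta>) / 2))"
    have "(\<lambda>n. cos_error \<nu> h \<theta> / sqrt (a n)) \<longlonglongrightarrow> 0"
      by (intro tendsto_divide_0[OF tendsto_const] filterlim_at_top_imp_at_infinity
          filterlim_compose[OF sqrt_at_top assms(6)])
    then have lim: "(\<lambda>n. cos_error \<nu> h \<theta> / sqrt (a (Suc n))) \<longlonglongrightarrow> 0" by (rule LIMSEQ_Suc)
    have "\<bar>(\<integral>y. cos (\<theta> \<bullet> y + c) \<partial>\<mu> (Suc n)) - ?l\<bar> \<le> cos_error \<nu> h \<theta> / sqrt (a (Suc n))" for n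
      using stationary_switching.expectation_cos_fluctuation_approx[OF S, where \<theta> = \<theta> and c = c]
      unfolding \<mu>_eq by (simp add: stationary_switching.integral_rescaled_law[OF S, where f = "\<lambda>x. cos (x + c)"])
    then have "(\<lambda>n. (\<integral>y. cos (\<theta> \<bullet> y + c) \<partial>\<mu> (Suc n)) - ?l) \<longlonglongrightarrow> 0"
      by (intro Lim_null_comparison[OF _ lim]) auto
    then show "(\<lambda>n. \<integral>y. cos (\<theta> \<bullet> y + c) \<partial>\<mu> (Suc n)) \<longlonglongrightarrow> (\<integral>y. cos (\<theta> \<bullet> y + c) \<partial>G)"
      unfolding integral_cos_centered_gaussian[OF G] by (rule LIM_zero_cancel)
  qed
  then have "converges_weakly \<mu> G"
    unfolding converges_weakly_def by (blast intro: LIMSEQ_imp_Suc)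
  then show ?thesis using G unfolding \<mu>_def by blast
qed

end
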